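(* Let $\mathbb{F}$ be a field and let $A=\otimes_{i=1}^{\infty}A_i$ be a countable-dimensional unital locally matrix algebra, where $A_i\cong M_{n_i}(\mathbb{F})$, $i\ge1$. For each $n\ge1$ let $H_n$ be the subgroup of $\mathrm{Inn}(A)$ generated by conjugations by invertible elements from $\otimes_{i\ge n}A_i$. Then an injective endomorphism $$\varphi=\varphi_1\varphi_2\cdots,\qquad \text{where } \varphi_n\in H_n,\ n\ge1,$$ is an automorphism of $A$ if and only if the sequence $\{\varphi_n^{-1}\}_{n\ge1}$ is integrable.
   Context: An associative $\mathbb{F}$-algebra $A$ is a locally matrix algebra if every finite subset of $A$ is contained in a subalgebra $B\subset A$ with $B\cong M_n(\mathbb{F})$ for some $n$; it is unital if it has a unit $1$. Countable-dimensional means of dimension $\aleph_0$ over $\mathbb{F}$. By a theorem of Koethe every countable-dimensional unital locally matrix algebra is isomorphic to a countable tensor product of matrix algebras. The infinite tensor product $\otimes_{i=1}^\infty A_i$ is the direct limit of the finite tensor products $A_1\otimes\cdots\otimes A_m$ (embedded via $x\mapsto x\otimes1$); $\otimes_{i\ge n}A_i$ is regarded as a subalgebra of $A$ by filling in units in positions $1,\dots,n-1$. $\mathrm{Inn}(A)$ is the group of inner automorphisms $x\mapsto a^{-1}xa$, $a\in A$ invertible. For a sequence $\varphi_n\in H_n$, $n\ge1$, the infinite product $\varphi_1\varphi_2\cdots$ is the limit of the compositions $\varphi_1\varphi_2\cdots\varphi_m=\varphi_1\circ\varphi_2\circ\cdots\circ\varphi_m$ in the Tykhonoff topology (pointwise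 convergence with $A$ discrete): for $a\in A_1\otimes\cdots\otimes A_k$, its value at $a$ is $\varphi_1\cdots\varphi_m(a)$ for all $m\ge k$ (this is independent of $m\ge k$, since every element of $H_n$ fixes $A_1\otimes\cdots\otimes A_{n-1}$ elementwise). This limit is a unital injective endomorphism of $A$. A sequence of automorphisms $\psi_n\in H_n$, $n\ge1$, is called integrable if for an arbitrary element $a\in A$ the subspace spanned by all elements $\psi_n\psi_{n-1}\cdots\psi_1(a)$, $n\ge1$, is finite-dimensional. *)

theory Defs
  imports
    "HOL-Algebra.QuotRing"
    "HOL-Algebra.Bij"
    "HOL-Algebra.Generated_Groups"
    "HOL-Analysis.Function_Topology"
    "HOL-Library.Poly_Mapping"
    "HOL-Library.Countable_Set"
    "Jordan_Normal_Form.VS_Connect"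
begin

section \<open>Associative algebras over a field\<close>

text \<open>
  The ground field is the type \<open>'f\<close>, regarded as a ring record through \<^term>\<open>class_ring\<close>. An algebra
  is a record of type \<^typ>\<open>('f, 'a) module\<close>, which comes with a multiplication and a unit; the
  library locale \<^locale>\<open>algebra\<close> is not used because it is restricted to commutative algebras.
\<close>

definition unital_algebra :: "('f::field, 'a) module \<Rightarrow> bool" where
  "unital_algebra A \<longleftrightarrow> ring A \<and> Module.module class_ring A \<and>
     (\<forall>c. \<forall>x\<in>carrier A. \<forall>y\<in>carrier A.
        (c \<odot>\<^bsub>A\<^esub> x) \<otimes>\<^bsub>A\<^esub> y = c \<odot>\<^bsub>A\<^esub> (x \<otimes>\<^bsub>A\<^esub> y) \<and>
        x \<otimes>\<^bsub>A\<^esub> (c \<odot>\<^bsub>A\<^esub> y) = c \<odot>\<^bsub>A\<^esub> (x \<otimes>\<^bsub>A\<^esub> y))"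

definition alg_hom :: "('f::field, 'a) module \<Rightarrow> ('f, 'b) module \<Rightarrow> ('a \<Rightarrow> 'b) set" where
  "alg_hom A B = Ring.ring_hom A B \<inter> module_hom class_ring A B"

definition alg_isomorphic :: "('f::field, 'a) module \<Rightarrow> ('f, 'b) module \<Rightarrow> bool" where
  "alg_isomorphic A B \<longleftrightarrow> (\<exists>f \<in> alg_hom A B. bij_betw f (carrier A) (carrier B))"

definition alg_auto :: "('f::field, 'a) module \<Rightarrow> ('a \<Rightarrow> 'a) set" where
  "alg_auto A = alg_hom A A \<inter> Bij (carrier A)"

definition matrix_algebra :: "nat \<Rightarrow> ('f::field, 'f mat) module" where
  "matrix_algebra n = module_mat TYPE('f) n n"

text \<open>
  A subalgebra need not contain the unit of \<open>A\<close>: if it is isomorphic to a matrix algebra, then it has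
  its own unit \<open>e\<close>.
\<close>

definition subalgebra_set :: "'a set \<Rightarrow> ('f::field, 'a) module \<Rightarrow> bool" where
  "subalgebra_set B A \<longleftrightarrow> submodule class_ring B A \<and> (\<forall>x\<in>B. \<forall>y\<in>B. x \<otimes>\<^bsub>A\<^esub> y \<in> B)"

definition locally_matrix_algebra :: "('f::field, 'a) module \<Rightarrow> bool" where
  "locally_matrix_algebra A \<longleftrightarrow>
     (\<forall>S. finite S \<and> S \<subseteq> carrier A \<longrightarrow>
        (\<exists>B e n. subalgebra_set B A \<and> S \<subseteq> B \<and> 0 < n \<and> e \<in> B \<and>
           alg_isomorphic (A\<lparr>carrier := B, one := e\<rparr>) (matrix_algebra n)))"

definition countable_dimensional :: "('f::field, 'a) module \<Rightarrow> bool" where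
  "countable_dimensional A \<longleftrightarrow>
     (\<exists>X. vectorspace.basis class_ring A X \<and> infinite X \<and> countable X)"

definition spans_fin_dim :: "('f::field, 'a) module \<Rightarrow> 'a set \<Rightarrow> bool" where
  "spans_fin_dim A E \<longleftrightarrow>
     vectorspace.fin_dim class_ring (A\<lparr>carrier := LinearCombinations.module.span class_ring A E\<rparr>)"


section \<open>Tensor products\<close>

text \<open>
  The tensor product of a family \<open>(A i)\<^bsub>i \<in> I\<^esub>\<close> of algebras is the free vector space on the cartesian
  product of the carriers modulo the span of the multilinearity relations. The multiplication is
  induced by the componentwise multiplication of tuples.
\<close>

definition free_tensor ::
  "'i set \<Rightarrow> ('i \<Rightarrow> ('f::field, 'a) module) \<Rightarrow> ('f, ('i \<Rightarrow> 'a) \<Rightarrow>\<^sub>0 'f) module" where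
  "free_tensor I A =
    \<lparr>carrier = {p. Poly_Mapping.keys p \<subseteq> (\<Pi>\<^sub>E i\<in>I. carrier (A i))},
     monoid.mult = (\<lambda>p q. \<Sum>x\<in>Poly_Mapping.keys p. \<Sum>y\<in>Poly_Mapping.keys q.
       Poly_Mapping.single (\<lambda>i\<in>I. x i \<otimes>\<^bsub>A i\<^esub> y i) (Poly_Mapping.lookup p x * Poly_Mapping.lookup q y)),
     one = Poly_Mapping.single (\<lambda>i\<in>I. \<one>\<^bsub>A i\<^esub>) 1,
     zero = 0,
     add = (+),
     module.smult = (\<lambda>c p. Poly_Mapping.map (\<lambda>b. c * b) p)\<rparr>"

definition tensor_relations ::
  "'i set \<Rightarrow> ('i \<Rightarrow> ('f::field, 'a) module) \<Rightarrow> (('i \<Rightarrow> 'a) \<Rightarrow>\<^sub>0 'f) set" where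
  "tensor_relations I A =
     {Poly_Mapping.single (x(i := a \<oplus>\<^bsub>A i\<^esub> b)) 1
        - Poly_Mapping.single (x(i := a)) 1 - Poly_Mapping.single (x(i := b)) 1 | x i a b.
        x \<in> (\<Pi>\<^sub>E i\<in>I. carrier (A i)) \<and> i \<in> I \<and> a \<in> carrier (A i) \<and> b \<in> carrier (A i)}
   \<union> {Poly_Mapping.single (x(i := c \<odot>\<^bsub>A i\<^esub> a)) 1 - Poly_Mapping.single (x(i := a)) c | x i c a.
        x \<in> (\<Pi>\<^sub>E i\<in>I. carrier (A i)) \<and> i \<in> I \<and> a \<in> carrier (A i)}"

definition tensor_null ::
  "'i set \<Rightarrow> ('i \<Rightarrow> ('f::field, 'a) module) \<Rightarrow> (('i \<Rightarrow> 'a) \<Rightarrow>\<^sub>0 'f) set" where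
  "tensor_null I A =
     LinearCombinations.module.span class_ring (free_tensor I A) (tensor_relations I A)"

definition tensor_product ::
  "'i set \<Rightarrow> ('i \<Rightarrow> ('f::field, 'a) module) \<Rightarrow> ('f, (('i \<Rightarrow> 'a) \<Rightarrow>\<^sub>0 'f) set) module" where
  "tensor_product I A =
     ring.extend (free_tensor I A Quot tensor_null I A)
       (module.fields (\<lambda>c X. \<Union>p\<in>X.
          tensor_null I A +>\<^bsub>free_tensor I A\<^esub> (c \<odot>\<^bsub>free_tensor I A\<^esub> p)))"

text \<open>
  For \<open>J \<subseteq> I\<close>, the map from the tensor product over \<open>J\<close> to the tensor product over \<open>I\<close> that fills in
  units in the positions outside \<open>J\<close>. For \<open>J = {1..m}\<close> and \<open>I = {1..m+1}\<close> it is \<open>x \<mapsto> x \<otimes> 1\<close>.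
\<close>

definition fill_units ::
  "('i \<Rightarrow> ('f::field, 'a) module) \<Rightarrow> 'i set \<Rightarrow> 'i set \<Rightarrow>
     (('i \<Rightarrow> 'a) \<Rightarrow>\<^sub>0 'f) set \<Rightarrow> (('i \<Rightarrow> 'a) \<Rightarrow>\<^sub>0 'f) set" where
  "fill_units A J I X = (\<Union>p\<in>X. tensor_null I A +>\<^bsub>free_tensor I A\<^esub>
     (\<Sum>x\<in>Poly_Mapping.keys p.
        Poly_Mapping.single (\<lambda>i\<in>I. if i \<in> J then x i else \<one>\<^bsub>A i\<^esub>) (Poly_Mapping.lookup p x)))"


section \<open>Direct limits of sequences of algebras\<close>

text \<open>\<open>h m k\<close> is the structure map from \<open>B m\<close> to \<open>B k\<close>, for \<open>m \<le> k\<close>.\<close>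

definition dirlim_rel ::
  "(nat \<Rightarrow> ('f::field, 'b) module) \<Rightarrow> (nat \<Rightarrow> nat \<Rightarrow> 'b \<Rightarrow> 'b) \<Rightarrow> ((nat \<times> 'b) \<times> (nat \<times> 'b)) set" where
  "dirlim_rel B h = {((m, x), (k, y)). x \<in> carrier (B m) \<and> y \<in> carrier (B k) \<and>
     (\<exists>l. m \<le> l \<and> k \<le> l \<and> h m l x = h k l y)}"

definition dirlim_class ::
  "(nat \<Rightarrow> ('f::field, 'b) module) \<Rightarrow> (nat \<Rightarrow> nat \<Rightarrow> 'b \<Rightarrow> 'b) \<Rightarrow> nat \<Rightarrow> 'b \<Rightarrow> (nat \<times> 'b) set" where
  "dirlim_class B h m x = dirlim_rel B h `` {(m, x)}"

definition dirlim ::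
  "(nat \<Rightarrow> ('f::field, 'b) module) \<Rightarrow> (nat \<Rightarrow> nat \<Rightarrow> 'b \<Rightarrow> 'b) \<Rightarrow> ('f, (nat \<times> 'b) set) module" where
  "dirlim B h =
    \<lparr>carrier = (SIGMA m:UNIV. carrier (B m)) // dirlim_rel B h,
     monoid.mult = (\<lambda>X Y. \<Union>(m, x)\<in>X. \<Union>(k, y)\<in>Y.
       dirlim_class B h (max m k) (h m (max m k) x \<otimes>\<^bsub>B (max m k)\<^esub> h k (max m k) y)),
     one = dirlim_class B h 0 \<one>\<^bsub>B 0\<^esub>,
     zero = dirlim_class B h 0 \<zero>\<^bsub>B 0\<^esub>,
     add = (\<lambda>X Y. \<Union>(m, x)\<in>X. \<Union>(k, y)\<in>Y.
       dirlim_class B h (max m k) (h m (max m k) x \<oplus>\<^bsub>B (max m k)\<^esub> h k (max m k) y)),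
     module.smult = (\<lambda>c X. \<Union>(m, x)\<in>X. dirlim_class B h m (c \<odot>\<^bsub>B m\<^esub> x))\<rparr>"


section \<open>The infinite tensor product\<close>

text \<open>
  The factors are \<open>A 1, A 2, \<dots>\<close>; \<open>A 0\<close> is not used. The direct system begins with the empty tensor
  product, which is the ground field; this does not affect the limit.
\<close>

definition fin_tensor ::
  "(nat \<Rightarrow> ('f::field, 'a) module) \<Rightarrow> nat \<Rightarrow> ('f, ((nat \<Rightarrow> 'a) \<Rightarrow>\<^sub>0 'f) set) module" where
  "fin_tensor A m = tensor_product {1..m} A"

definition fin_tensor_map ::
  "(nat \<Rightarrow> ('f::field, 'a) module) \<Rightarrow> nat \<Rightarrow> nat \<Rightarrow>
     ((nat \<Rightarrow> 'a) \<Rightarrow>\<^sub>0 'f) set \<Rightarrow> ((nat \<Rightarrow> 'a) \<Rightarrow>\<^sub>0 'f) set" where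
  "fin_tensor_map A m k = fill_units A {1..m} {1..k}"

type_synonym ('f, 'a) inf_tensor_elem = "(nat \<times> ((nat \<Rightarrow> 'a) \<Rightarrow>\<^sub>0 'f) set) set"

definition inf_tensor ::
  "(nat \<Rightarrow> ('f::field, 'a) module) \<Rightarrow> ('f, ('f, 'a) inf_tensor_elem) module" where
  "inf_tensor A = dirlim (fin_tensor A) (fin_tensor_map A)"

text \<open>
  The tensor product of the factors with index at least \<open>n\<close>, as a subset of \<^term>\<open>inf_tensor A\<close>: the
  union over \<open>m\<close> of the images of \<open>A n \<otimes> \<dots> \<otimes> A m\<close>, with units in the positions \<open>1, \<dots>, n - 1\<close>.
\<close>

definition tail_tensor ::
  "(nat \<Rightarrow> ('f::field, 'a) module) \<Rightarrow> nat \<Rightarrow> ('f, 'a) inf_tensor_elem set" where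
  "tail_tensor A n =
     {dirlim_class (fin_tensor A) (fin_tensor_map A) m (fill_units A {n..m} {1..m} x) | m x.
        x \<in> carrier (tensor_product {n..m} A)}"


section \<open>Inner automorphisms, infinite products, integrable sequences\<close>

definition conjugation :: "('f::field, 'a) module \<Rightarrow> 'a \<Rightarrow> 'a \<Rightarrow> 'a" where
  "conjugation A a = (\<lambda>x\<in>carrier A. inv\<^bsub>A\<^esub> a \<otimes>\<^bsub>A\<^esub> x \<otimes>\<^bsub>A\<^esub> a)"

definition Inn :: "('f::field, 'a) module \<Rightarrow> ('a \<Rightarrow> 'a) monoid" where
  "Inn A = BijGroup (carrier A) \<lparr>carrier := conjugation A ` Units A\<rparr>"

definition tail_inner ::
  "(nat \<Rightarrow> ('f::field, 'a) module) \<Rightarrow> nat \<Rightarrow>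
     (('f, 'a) inf_tensor_elem \<Rightarrow> ('f, 'a) inf_tensor_elem) set" where
  "tail_inner A n = generate (Inn (inf_tensor A))
     (conjugation (inf_tensor A) ` (tail_tensor A n \<inter> Units (inf_tensor A)))"

primrec partial_product :: "('f::field, 'a) module \<Rightarrow> (nat \<Rightarrow> 'a \<Rightarrow> 'a) \<Rightarrow> nat \<Rightarrow> 'a \<Rightarrow> 'a" where
  "partial_product A \<phi> 0 = (\<lambda>x\<in>carrier A. x)"
| "partial_product A \<phi> (Suc m) = compose (carrier A) (partial_product A \<phi> m) (\<phi> (Suc m))"

text \<open>The topology is Hausdorff, so the limit of the partial products is unique if it exists.\<close>

definition infinite_product :: "('f::field, 'a) module \<Rightarrow> (nat \<Rightarrow> 'a \<Rightarrow> 'a) \<Rightarrow> 'a \<Rightarrow> 'a" where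
  "infinite_product A \<phi> =
     (THE \<psi>. limitin (product_topology (\<lambda>_. discrete_topology (carrier A)) (carrier A))
                (partial_product A \<phi>) \<psi> sequentially)"

primrec iterated_image :: "(nat \<Rightarrow> 'a \<Rightarrow> 'a) \<Rightarrow> nat \<Rightarrow> 'a \<Rightarrow> 'a" where
  "iterated_image \<psi> 0 a = a"
| "iterated_image \<psi> (Suc m) a = \<psi> (Suc m) (iterated_image \<psi> m a)"

definition integrable_seq ::
  "(nat \<Rightarrow> ('f::field, 'a) module) \<Rightarrow>
     (nat \<Rightarrow> ('f, 'a) inf_tensor_elem \<Rightarrow> ('f, 'a) inf_tensor_elem) \<Rightarrow> bool" where
  "integrable_seq A \<psi> \<longleftrightarrow> (\<forall>n\<ge>1. \<psi> n \<in> tail_inner A n) \<and>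
     (\<forall>a\<in>carrier (inf_tensor A). spans_fin_dim (inf_tensor A) {iterated_image \<psi> n a | n. n \<ge> 1})"

end

theory Submission
  imports Defs "HOL-Analysis.Abstract_Topological_Spaces"
begin

text \<open>
  Write \<open>R\<close> for the infinite tensor product and \<open>P k\<close> for the image of \<open>A 1 \<otimes> \<dots> \<otimes> A k\<close> in \<open>R\<close>. The
  subspaces \<open>P k\<close> increase and exhaust \<open>R\<close>. An element of \<open>P k\<close> and an element of the tail
  \<open>A (k+1) \<otimes> A (k+2) \<otimes> \<dots>\<close> are represented by tuples whose entries outside disjoint index sets are
  units, so they commute (\<open>tail_commutes_with_head\<close>). Hence the group generated by the conjugations
  with units of that tail fixes \<open>P k\<close> elementwise (\<open>Inn_centralizer\<close>). Consequently the partial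
  products \<open>\<phi> 1 \<circ> \<dots> \<circ> \<phi> m\<close> with \<open>m \<ge> k\<close> agree on \<open>P k\<close>, the limit \<open>\<phi>\<close> exists, and it is an injective
  homomorphism because each restriction to \<open>P k\<close> is a restriction of an automorphism. It remains to
  compare surjectivity with integrability. Put \<open>a\<^sub>n = (\<phi> 1 \<circ> \<dots> \<circ> \<phi> n)\<inverse> a\<close>; this is the orbit in the
  definition of integrability.

  If \<open>a = \<phi> b\<close> with \<open>b \<in> P k\<close>, then \<open>a = (\<phi> 1 \<circ> \<dots> \<circ> \<phi> n) b\<close> for all \<open>n \<ge> k\<close>, so \<open>a\<^sub>n = b\<close> from \<open>k\<close> on and
  the orbit is finite. Conversely, if the orbit spans a finite-dimensional space, then a finite
  generating set, hence the orbit, lies in some \<open>P m\<close>. For \<open>n > m\<close> the map \<open>\<phi>\<close> agrees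
  with \<open>\<phi> 1 \<circ> \<dots> \<circ> \<phi> n\<close> at \<open>a\<^sub>n\<close>, so \<open>\<phi> a\<^sub>n = a\<close> and \<open>\<phi>\<close> is surjective. This comparison is
  \<open>infinite_product_auto_iff_orbits\<close>.

  Most of the text verifies that the explicit constructions have the expected algebraic structure:
  the free algebra on tuples is an associative algebra, the multilinearity relations span an ideal,
  filling in units is a homomorphism of the quotients, and the direct limit of algebras is an
  algebra. Identities are checked on tuples and extended by linearity
  (\<open>finitely_supported_induct\<close>), then carried over to quotients and limits by
  \<open>unital_algebra_directed_image\<close>.
\<close>

section \<open>Unital algebras and their homomorphic images\<close>

lemma unital_algebraI:
  fixes A :: "('f::field, 'a) module" (structure)
  assumes "abelian_group A" "monoid A"
    and "\<And>x y z. \<lbrakk>x \<in> carrier A; y \<in> carrier A; z \<in> carrier A\<rbrakk> \<Longrightarrow> (x \<oplus> y) \<otimes> z = x \<otimes> z \<oplus> y \<otimes> z"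
    and "\<And>x y z. \<lbrakk>x \<in> carrier A; y \<in> carrier A; z \<in> carrier A\<rbrakk> \<Longrightarrow> z \<otimes> (x \<oplus> y) = z \<otimes> x \<oplus> z \<otimes> y"
    and "\<And>c x. x \<in> carrier A \<Longrightarrow> c \<odot>\<^bsub>A\<^esub> x \<in> carrier A"
    and "\<And>c d x. x \<in> carrier A \<Longrightarrow> (c + d) \<odot>\<^bsub>A\<^esub> x = c \<odot>\<^bsub>A\<^esub> x \<oplus> d \<odot>\<^bsub>A\<^esub> x"
    and "\<And>c x y. \<lbrakk>x \<in> carrier A; y \<in> carrier A\<rbrakk> \<Longrightarrow> c \<odot>\<^bsub>A\<^esub> (x \<oplus> y) = c \<odot>\<^bsub>A\<^esub> x \<oplus> c \<odot>\<^bsub>A\<^esub> y"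
    and "\<And>c d x. x \<in> carrier A \<Longrightarrow> (c * d) \<odot>\<^bsub>A\<^esub> x = c \<odot>\<^bsub>A\<^esub> (d \<odot>\<^bsub>A\<^esub> x)"
    and "\<And>x. x \<in> carrier A \<Longrightarrow> 1 \<odot>\<^bsub>A\<^esub> x = x"
    and "\<And>c x y. \<lbrakk>x \<in> carrier A; y \<in> carrier A\<rbrakk> \<Longrightarrow> (c \<odot>\<^bsub>A\<^esub> x) \<otimes> y = c \<odot>\<^bsub>A\<^esub> (x \<otimes> y)"
    and "\<And>c x y. \<lbrakk>x \<in> carrier A; y \<in> carrier A\<rbrakk> \<Longrightarrow> x \<otimes> (c \<odot>\<^bsub>A\<^esub> y) = c \<odot>\<^bsub>A\<^esub> (x \<otimes> y)"
  shows "unital_algebra A"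
proof -
  have "cring (class_ring :: 'f ring)"
    using class_field fieldE(1) by blast
  then have "Module.module class_ring A"
    by (intro Module.moduleI) (simp_all add: assms)
  moreover have "ring A"
    by (intro ringI assms)
  ultimately show ?thesis
    unfolding unital_algebra_def by (simp add: assms)
qed

lemma unital_algebraD:
  assumes "unital_algebra A"
  shows "ring A" "Module.module class_ring A"
    and "\<lbrakk>x \<in> carrier A; y \<in> carrier A\<rbrakk> \<Longrightarrow> (c \<odot>\<^bsub>A\<^esub> x) \<otimes>\<^bsub>A\<^esub> y = c \<odot>\<^bsub>A\<^esub> (x \<otimes>\<^bsub>A\<^esub> y)"
    and "\<lbrakk>x \<in> carrier A; y \<in> carrier A\<rbrakk> \<Longrightarrow> x \<otimes>\<^bsub>A\<^esub> (c \<odot>\<^bsub>A\<^esub> y) = c \<odot>\<^bsub>A\<^esub> (x \<otimes>\<^bsub>A\<^esub> y)"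
  using assms unfolding unital_algebra_def by auto

lemma unital_algebra_smult:
  fixes A :: "('f::field, 'a) module"
  assumes "unital_algebra A"
  shows "x \<in> carrier A \<Longrightarrow> c \<odot>\<^bsub>A\<^esub> x \<in> carrier A"
    and "x \<in> carrier A \<Longrightarrow> (c + d) \<odot>\<^bsub>A\<^esub> x = c \<odot>\<^bsub>A\<^esub> x \<oplus>\<^bsub>A\<^esub> d \<odot>\<^bsub>A\<^esub> x"
    and "\<lbrakk>x \<in> carrier A; y \<in> carrier A\<rbrakk> \<Longrightarrow> c \<odot>\<^bsub>A\<^esub> (x \<oplus>\<^bsub>A\<^esub> y) = c \<odot>\<^bsub>A\<^esub> x \<oplus>\<^bsub>A\<^esub> c \<odot>\<^bsub>A\<^esub> y"
    and "x \<in> carrier A \<Longrightarrow> (c * d) \<odot>\<^bsub>A\<^esub> x = c \<odot>\<^bsub>A\<^esub> (d \<odot>\<^bsub>A\<^esub> x)"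
    and "x \<in> carrier A \<Longrightarrow> 1 \<odot>\<^bsub>A\<^esub> x = x"
    and "x \<in> carrier A \<Longrightarrow> 0 \<odot>\<^bsub>A\<^esub> x = \<zero>\<^bsub>A\<^esub>"
    and "c \<odot>\<^bsub>A\<^esub> \<zero>\<^bsub>A\<^esub> = \<zero>\<^bsub>A\<^esub>"
proof -
  interpret M: Module.module "class_ring :: 'f ring" A
    using assms by (rule unital_algebraD(2))
  show "x \<in> carrier A \<Longrightarrow> c \<odot>\<^bsub>A\<^esub> x \<in> carrier A"
    using M.smult_closed[of c x] by simp
  show "x \<in> carrier A \<Longrightarrow> (c + d) \<odot>\<^bsub>A\<^esub> x = c \<odot>\<^bsub>A\<^esub> x \<oplus>\<^bsub>A\<^esub> d \<odot>\<^bsub>A\<^esub> x"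
    using M.smult_l_distr[of c d x] by simp
  show "\<lbrakk>x \<in> carrier A; y \<in> carrier A\<rbrakk> \<Longrightarrow> c \<odot>\<^bsub>A\<^esub> (x \<oplus>\<^bsub>A\<^esub> y) = c \<odot>\<^bsub>A\<^esub> x \<oplus>\<^bsub>A\<^esub> c \<odot>\<^bsub>A\<^esub> y"
    using M.smult_r_distr[of c x y] by simp
  show "x \<in> carrier A \<Longrightarrow> (c * d) \<odot>\<^bsub>A\<^esub> x = c \<odot>\<^bsub>A\<^esub> (d \<odot>\<^bsub>A\<^esub> x)"
    using M.smult_assoc1[of c d x] by simp
  show "x \<in> carrier A \<Longrightarrow> 1 \<odot>\<^bsub>A\<^esub> x = x"
    using M.smult_one[of x] by simp
  show "x \<in> carrier A \<Longrightarrow> 0 \<odot>\<^bsub>A\<^esub> x = \<zero>\<^bsub>A\<^esub>"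
    using M.smult_l_null[of x] by simp
  show "c \<odot>\<^bsub>A\<^esub> \<zero>\<^bsub>A\<^esub> = \<zero>\<^bsub>A\<^esub>"
    using M.smult_r_null[of c] by simp
qed

lemma alg_homI:
  assumes "\<And>x. x \<in> carrier A \<Longrightarrow> f x \<in> carrier B"
    and "\<And>x y. \<lbrakk>x \<in> carrier A; y \<in> carrier A\<rbrakk> \<Longrightarrow> f (x \<oplus>\<^bsub>A\<^esub> y) = f x \<oplus>\<^bsub>B\<^esub> f y"
    and "\<And>x y. \<lbrakk>x \<in> carrier A; y \<in> carrier A\<rbrakk> \<Longrightarrow> f (x \<otimes>\<^bsub>A\<^esub> y) = f x \<otimes>\<^bsub>B\<^esub> f y"
    and "\<And>c x. x \<in> carrier A \<Longrightarrow> f (c \<odot>\<^bsub>A\<^esub> x) = c \<odot>\<^bsub>B\<^esub> f x"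
    and "f \<one>\<^bsub>A\<^esub> = \<one>\<^bsub>B\<^esub>"
  shows "f \<in> alg_hom A B"
  unfolding alg_hom_def module_hom_def by (auto intro!: ring_hom_memI simp: assms)

lemma alg_homD:
  assumes "f \<in> alg_hom A B"
  shows "x \<in> carrier A \<Longrightarrow> f x \<in> carrier B"
    and "\<lbrakk>x \<in> carrier A; y \<in> carrier A\<rbrakk> \<Longrightarrow> f (x \<oplus>\<^bsub>A\<^esub> y) = f x \<oplus>\<^bsub>B\<^esub> f y"
    and "\<lbrakk>x \<in> carrier A; y \<in> carrier A\<rbrakk> \<Longrightarrow> f (x \<otimes>\<^bsub>A\<^esub> y) = f x \<otimes>\<^bsub>B\<^esub> f y"
    and "x \<in> carrier A \<Longrightarrow> f (c \<odot>\<^bsub>A\<^esub> x) = c \<odot>\<^bsub>B\<^esub> f x"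
    and "f \<one>\<^bsub>A\<^esub> = \<one>\<^bsub>B\<^esub>"
  using assms unfolding alg_hom_def module_hom_def
  by (auto simp: ring_hom_closed ring_hom_mult ring_hom_one)

text \<open>
  Each axiom involves at most three elements, and these have preimages in a single \<open>A m\<close>. The
  constant family gives quotients; an increasing family gives direct limits.
\<close>

lemma unital_algebra_directed_image:
  fixes A :: "nat \<Rightarrow> ('f::field, 'a) module" and B :: "('f, 'b) module"
  assumes A: "\<And>m. unital_algebra (A m)"
    and f: "\<And>m. f m \<in> alg_hom (A m) B"
    and f_zero: "\<And>m. f m \<zero>\<^bsub>A m\<^esub> = \<zero>\<^bsub>B\<^esub>"
    and chain: "\<And>m k. m \<le> k \<Longrightarrow> f m ` carrier (A m) \<subseteq> f k ` carrier (A k)"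
    and cover: "carrier B \<subseteq> (\<Union>m. f m ` carrier (A m))"
  shows "unital_algebra B"
proof -
  note R [simp] = ring.ring_simprules(1,2,5-8,11-13)[OF unital_algebraD(1)[OF A]]
  note S [simp] = unital_algebra_smult[OF A] unital_algebraD(3,4)[OF A]
  note f_simps [simp] = alg_homD(1)[OF f]
  \<comment> \<open>Oriented from \<open>B\<close> to \<open>A m\<close>: expressions in images are collected under one \<open>f m\<close>.\<close>
  note f_ops = alg_homD(2-4)[OF f, symmetric]
  have one: "\<one>\<^bsub>B\<^esub> = f m \<one>\<^bsub>A m\<^esub>" for m
    using alg_homD(5)[OF f] by simp
  note zero = f_zero[symmetric]
  have rep1: "\<exists>m a. a \<in> carrier (A m) \<and> x = f m a" if "x \<in> carrier B" for x
    using cover that by blast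
  have lift: "\<exists>a'\<in>carrier (A k). f m a = f k a'" if "m \<le> k" "a \<in> carrier (A m)" for m k a
    using chain[OF that(1)] that(2) by blast
  have rep2: "\<exists>m a b. a \<in> carrier (A m) \<and> b \<in> carrier (A m) \<and> x = f m a \<and> y = f m b"
    if xy: "x \<in> carrier B" "y \<in> carrier B" for x y
  proof -
    obtain m a where a: "a \<in> carrier (A m)" "x = f m a"
      using rep1 xy by blast
    obtain k b where b: "b \<in> carrier (A k)" "y = f k b"
      using rep1 xy by blast
    show ?thesis
      using lift[of m "max m k" a] lift[of k "max m k" b] a b by (simp del: f_simps) blast
  qed
  have rep3: "\<exists>m a b c. a \<in> carrier (A m) \<and> b \<in> carrier (A m) \<and> c \<in> carrier (A m)
      \<and> x = f m a \<and> y = f m b \<and> z = f m c"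
    if xyz: "x \<in> carrier B" "y \<in> carrier B" "z \<in> carrier B" for x y z
  proof -
    obtain m a b where ab: "a \<in> carrier (A m)" "x = f m a" "b \<in> carrier (A m)" "y = f m b"
      using rep2[OF xyz(1,2)] by blast
    obtain k c where c: "c \<in> carrier (A k)" "z = f k c"
      using rep1 xyz by blast
    show ?thesis
      using lift[of m "max m k" a] lift[of m "max m k" b] lift[of k "max m k" c] ab c
      by (simp del: f_simps) blast
  qed
  have add_group: "abelian_group B"
  proof (rule abelian_groupI)
    show "x \<oplus>\<^bsub>B\<^esub> y \<in> carrier B" if "x \<in> carrier B" "y \<in> carrier B" for x y
      using rep2[OF that] by (auto simp: f_ops)
    show "\<zero>\<^bsub>B\<^esub> \<in> carrier B"
      by (simp add: zero[of 0])
    show "x \<oplus>\<^bsub>B\<^esub> y \<oplus>\<^bsub>B\<^esub> z = x \<oplus>\<^bsub>B\<^esub> (y \<oplus>\<^bsub>B\<^esub> z)"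
      if "x \<in> carrier B" "y \<in> carrier B" "z \<in> carrier B" for x y z
      using rep3[OF that] by (auto simp: f_ops)
    show "x \<oplus>\<^bsub>B\<^esub> y = y \<oplus>\<^bsub>B\<^esub> x" if "x \<in> carrier B" "y \<in> carrier B" for x y
    proof -
      obtain m a b where "a \<in> carrier (A m)" "b \<in> carrier (A m)" "x = f m a" "y = f m b"
        using rep2[OF \<open>x \<in> carrier B\<close> \<open>y \<in> carrier B\<close>] by blast
      then show ?thesis
        using abelian_monoid.a_comm[OF abelian_group.axioms(1)[OF ring.is_abelian_group[OF unital_algebraD(1)[OF A]]]]
        by (simp add: f_ops)
    qed
    show "\<zero>\<^bsub>B\<^esub> \<oplus>\<^bsub>B\<^esub> x = x" if "x \<in> carrier B" for x
    proof -
      obtain m a where a: "a \<in> carrier (A m)" "x = f m a"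
        using rep1 \<open>x \<in> carrier B\<close> by blast
      then show ?thesis
        by (simp add: zero[of m] f_ops)
    qed
    show "\<exists>y\<in>carrier B. y \<oplus>\<^bsub>B\<^esub> x = \<zero>\<^bsub>B\<^esub>" if "x \<in> carrier B" for x
    proof -
      obtain m a where a: "a \<in> carrier (A m)" "x = f m a"
        using rep1 \<open>x \<in> carrier B\<close> by blast
      then have "\<ominus>\<^bsub>A m\<^esub> a \<in> carrier (A m)" "\<ominus>\<^bsub>A m\<^esub> a \<oplus>\<^bsub>A m\<^esub> a = \<zero>\<^bsub>A m\<^esub>"
        using unital_algebraD(1)[OF A] by (simp_all add: ring.ring_simprules(3,9))
      then show ?thesis
        using a by (intro bexI[of _ "f m (\<ominus>\<^bsub>A m\<^esub> a)"]) (simp_all add: f_ops f_zero)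
    qed
  qed
  have monoid: "monoid B"
  proof (rule monoidI)
    show "x \<otimes>\<^bsub>B\<^esub> y \<in> carrier B" if "x \<in> carrier B" "y \<in> carrier B" for x y
      using rep2[OF that] by (auto simp: f_ops)
    show "\<one>\<^bsub>B\<^esub> \<in> carrier B"
      by (simp add: one[of 0])
    show "x \<otimes>\<^bsub>B\<^esub> y \<otimes>\<^bsub>B\<^esub> z = x \<otimes>\<^bsub>B\<^esub> (y \<otimes>\<^bsub>B\<^esub> z)"
      if "x \<in> carrier B" "y \<in> carrier B" "z \<in> carrier B" for x y z
      using rep3[OF that] by (auto simp: f_ops)
    show "\<one>\<^bsub>B\<^esub> \<otimes>\<^bsub>B\<^esub> x = x" if "x \<in> carrier B" for x
    proof -
      obtain m a where a: "a \<in> carrier (A m)" "x = f m a"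
        using rep1 \<open>x \<in> carrier B\<close> by blast
      then show ?thesis
        by (simp add: one[of m] f_ops)
    qed
    show "x \<otimes>\<^bsub>B\<^esub> \<one>\<^bsub>B\<^esub> = x" if "x \<in> carrier B" for x
    proof -
      obtain m a where a: "a \<in> carrier (A m)" "x = f m a"
        using rep1 \<open>x \<in> carrier B\<close> by blast
      then show ?thesis
        using monoid.r_one[OF ring.is_monoid[OF unital_algebraD(1)[OF A]]]
        by (simp add: one[of m] f_ops)
    qed
  qed
  have r_distr: "c \<otimes>\<^bsub>A m\<^esub> (a \<oplus>\<^bsub>A m\<^esub> b) = c \<otimes>\<^bsub>A m\<^esub> a \<oplus>\<^bsub>A m\<^esub> c \<otimes>\<^bsub>A m\<^esub> b"
    if "a \<in> carrier (A m)" "b \<in> carrier (A m)" "c \<in> carrier (A m)" for a b c m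
    using ring.ring_simprules(23)[OF unital_algebraD(1)[OF A]] that by blast
  show ?thesis
  proof (rule unital_algebraI[OF add_group monoid])
    fix x y z assume xyz: "x \<in> carrier B" "y \<in> carrier B" "z \<in> carrier B"
    show "(x \<oplus>\<^bsub>B\<^esub> y) \<otimes>\<^bsub>B\<^esub> z = x \<otimes>\<^bsub>B\<^esub> z \<oplus>\<^bsub>B\<^esub> y \<otimes>\<^bsub>B\<^esub> z"
      and "z \<otimes>\<^bsub>B\<^esub> (x \<oplus>\<^bsub>B\<^esub> y) = z \<otimes>\<^bsub>B\<^esub> x \<oplus>\<^bsub>B\<^esub> z \<otimes>\<^bsub>B\<^esub> y"
      using rep3[OF xyz] by (auto simp: f_ops r_distr)
  next
    fix c d x assume x: "x \<in> carrier B"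
    show "c \<odot>\<^bsub>B\<^esub> x \<in> carrier B" and "(c + d) \<odot>\<^bsub>B\<^esub> x = c \<odot>\<^bsub>B\<^esub> x \<oplus>\<^bsub>B\<^esub> d \<odot>\<^bsub>B\<^esub> x"
      and "(c * d) \<odot>\<^bsub>B\<^esub> x = c \<odot>\<^bsub>B\<^esub> (d \<odot>\<^bsub>B\<^esub> x)" and "1 \<odot>\<^bsub>B\<^esub> x = x"
      using rep1[OF x] by (auto simp: f_ops)
  next
    fix c x y assume xy: "x \<in> carrier B" "y \<in> carrier B"
    show "c \<odot>\<^bsub>B\<^esub> (x \<oplus>\<^bsub>B\<^esub> y) = c \<odot>\<^bsub>B\<^esub> x \<oplus>\<^bsub>B\<^esub> c \<odot>\<^bsub>B\<^esub> y"
      and "(c \<odot>\<^bsub>B\<^esub> x) \<otimes>\<^bsub>B\<^esub> y = c \<odot>\<^bsub>B\<^esub> (x \<otimes>\<^bsub>B\<^esub> y)"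
      and "x \<otimes>\<^bsub>B\<^esub> (c \<odot>\<^bsub>B\<^esub> y) = c \<odot>\<^bsub>B\<^esub> (x \<otimes>\<^bsub>B\<^esub> y)"
      using rep2[OF xy] by (auto simp: f_ops)
  qed
qed

section \<open>The free algebra on tuples\<close>

lemma free_tensor_simps [simp]:
  "carrier (free_tensor I A) = {p. Poly_Mapping.keys p \<subseteq> (\<Pi>\<^sub>E i\<in>I. carrier (A i))}"
  "\<one>\<^bsub>free_tensor I A\<^esub> = Poly_Mapping.single (\<lambda>i\<in>I. \<one>\<^bsub>A i\<^esub>) 1"
  "\<zero>\<^bsub>free_tensor I A\<^esub> = 0"
  "p \<oplus>\<^bsub>free_tensor I A\<^esub> q = p + q"
  "c \<odot>\<^bsub>free_tensor I A\<^esub> p = Poly_Mapping.map ((*) c) p"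
  by (simp_all add: free_tensor_def)

lemma lookup_scale: "Poly_Mapping.lookup (Poly_Mapping.map ((*) (c::'f::field)) p) x = c * Poly_Mapping.lookup p x"
  by (simp add: Poly_Mapping.map.rep_eq when_def)

lemma keys_scale: "Poly_Mapping.keys (Poly_Mapping.map ((*) (c::'f::field)) p) \<subseteq> Poly_Mapping.keys p"
  by (auto simp: in_keys_iff lookup_scale)

lemma scale_simps [simp]:
  fixes c :: "'f::field"
  shows "Poly_Mapping.map ((*) c) (p + q) = Poly_Mapping.map ((*) c) p + Poly_Mapping.map ((*) c) q"
    and "Poly_Mapping.map ((*) c) (p - q) = Poly_Mapping.map ((*) c) p - Poly_Mapping.map ((*) c) q"
    and "Poly_Mapping.map ((*) c) 0 = 0"
    and "Poly_Mapping.map ((*) 1) p = p"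
  by (intro poly_mapping_eqI; simp add: lookup_scale lookup_add lookup_minus algebra_simps)+

lemma scale_add_left:
  "Poly_Mapping.map ((*) (c + d :: 'f::field)) p = Poly_Mapping.map ((*) c) p + Poly_Mapping.map ((*) d) p"
  by (intro poly_mapping_eqI) (simp add: lookup_scale lookup_add algebra_simps)

lemma scale_scale:
  "Poly_Mapping.map ((*) (c * d :: 'f::field)) p = Poly_Mapping.map ((*) c) (Poly_Mapping.map ((*) d) p)"
  by (intro poly_mapping_eqI) (simp add: lookup_scale algebra_simps)

lemma free_tensor_closed [simp]:
  "\<lbrakk>Poly_Mapping.keys p \<subseteq> X; Poly_Mapping.keys q \<subseteq> X\<rbrakk> \<Longrightarrow> Poly_Mapping.keys (p + q) \<subseteq> X"
  "\<lbrakk>Poly_Mapping.keys p \<subseteq> X; Poly_Mapping.keys r \<subseteq> X\<rbrakk> \<Longrightarrow> Poly_Mapping.keys (p - r :: 'x \<Rightarrow>\<^sub>0 'f::field) \<subseteq> X"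
  "Poly_Mapping.keys r \<subseteq> X \<Longrightarrow> Poly_Mapping.keys (Poly_Mapping.map ((*) c) r) \<subseteq> X"
  using keys_add[of p q] keys_diff[of p r] keys_scale[of c r] by blast+

text \<open>
  Linearity as an induction principle: an additive statement about finitely supported functions
  needs to be checked on single tuples.
\<close>

lemma finitely_supported_induct [consumes 1, case_names zero single add]:
  fixes p :: "'x \<Rightarrow>\<^sub>0 'f::field"
  assumes "Poly_Mapping.keys p \<subseteq> X"
    and "P 0"
    and "\<And>x c. x \<in> X \<Longrightarrow> P (Poly_Mapping.single x c)"
    and "\<And>p q. \<lbrakk>Poly_Mapping.keys p \<subseteq> X; Poly_Mapping.keys q \<subseteq> X; P p; P q\<rbrakk> \<Longrightarrow> P (p + q)"
  shows "P p"
proof -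
  have "P (\<Sum>x\<in>S. Poly_Mapping.single x (Poly_Mapping.lookup p x)) \<and>
      Poly_Mapping.keys (\<Sum>x\<in>S. Poly_Mapping.single x (Poly_Mapping.lookup p x)) \<subseteq> X"
    if "S \<subseteq> Poly_Mapping.keys p" for S
    using finite_subset[OF that finite_keys] that
  proof (induction S rule: finite_induct)
    case empty
    then show ?case using assms by simp
  next
    case (insert x S)
    then have "x \<in> X" using assms(1) by auto
    with insert show ?case
      using assms(3)[of x] by (auto intro!: assms(4) free_tensor_closed(1) split: if_splits)
  qed
  moreover have "(\<Sum>x\<in>Poly_Mapping.keys p. Poly_Mapping.single x (Poly_Mapping.lookup p x)) = p"
    by (rule poly_mapping_eqI)
      (simp add: lookup_sum lookup_single when_def in_keys_iff sum.delta)
  ultimately show ?thesis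
    by (metis order_refl)
qed

definition lin_ext :: "('x \<Rightarrow> 'y) \<Rightarrow> ('x \<Rightarrow>\<^sub>0 'f::field) \<Rightarrow> ('y \<Rightarrow>\<^sub>0 'f)" where
  "lin_ext f p = (\<Sum>x\<in>Poly_Mapping.keys p. Poly_Mapping.single (f x) (Poly_Mapping.lookup p x))"

lemma lin_ext_zero [simp]: "lin_ext f 0 = 0"
  by (simp add: lin_ext_def)

lemma lin_ext_single [simp]: "lin_ext f (Poly_Mapping.single x c) = Poly_Mapping.single (f x) c"
  by (simp add: lin_ext_def)

lemma lin_ext_add [simp]: "lin_ext f (p + q) = lin_ext f p + lin_ext f q"
  unfolding lin_ext_def
  by (rule setsum_keys_plus_distrib[where f = "\<lambda>x a. Poly_Mapping.single (f x) a"]) (simp_all add: single_add)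

lemma lin_ext_diff [simp]: "lin_ext f (p - q) = lin_ext f p - lin_ext f q"
  using lin_ext_add[of f "p - q" q] by (simp add: algebra_simps)

lemma lin_ext_scale [simp]:
  "lin_ext f (Poly_Mapping.map ((*) c) p) = Poly_Mapping.map ((*) c) (lin_ext f p)"
  by (induction p rule: finitely_supported_induct[OF subset_UNIV]) simp_all

lemma lin_ext_comp: "lin_ext f (lin_ext g p) = lin_ext (f \<circ> g) p"
  by (induction p rule: finitely_supported_induct[OF subset_UNIV]) simp_all

lemma lin_ext_cong:
  "(\<And>x. x \<in> Poly_Mapping.keys p \<Longrightarrow> f x = g x) \<Longrightarrow> lin_ext f p = lin_ext g p"
  by (simp add: lin_ext_def)

lemma lin_ext_id: "lin_ext (\<lambda>x. x) p = p"
  by (induction p rule: finitely_supported_induct[OF subset_UNIV]) simp_all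

lemma keys_lin_ext: "Poly_Mapping.keys (lin_ext f p) \<subseteq> f ` Poly_Mapping.keys p"
proof -
  have "Poly_Mapping.keys (lin_ext f p)
      \<subseteq> (\<Union>x\<in>Poly_Mapping.keys p. Poly_Mapping.keys (Poly_Mapping.single (f x) (Poly_Mapping.lookup p x)))"
    unfolding lin_ext_def by (rule keys_sum)
  then show ?thesis
    by (fastforce split: if_splits)
qed

lemma keys_lin_ext_subset:
  "\<lbrakk>Poly_Mapping.keys p \<subseteq> X; f ` X \<subseteq> Y\<rbrakk> \<Longrightarrow> Poly_Mapping.keys (lin_ext f p) \<subseteq> Y"
  using keys_lin_ext[of f p] by blast

lemma free_tensor_mult_eq:
  "p \<otimes>\<^bsub>free_tensor I A\<^esub> q =
     (\<Sum>x\<in>Poly_Mapping.keys p. \<Sum>y\<in>Poly_Mapping.keys q. Poly_Mapping.single (\<lambda>i\<in>I. x i \<otimes>\<^bsub>A i\<^esub> y i)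
       (Poly_Mapping.lookup p x * Poly_Mapping.lookup q y))"
  by (simp add: free_tensor_def)

lemma free_tensor_mult_single [simp]:
  "Poly_Mapping.single x c \<otimes>\<^bsub>free_tensor I A\<^esub> Poly_Mapping.single y d =
     Poly_Mapping.single (\<lambda>i\<in>I. x i \<otimes>\<^bsub>A i\<^esub> y i) (c * d)"
  by (simp add: free_tensor_mult_eq)

lemma free_tensor_mult_zero [simp]:
  "0 \<otimes>\<^bsub>free_tensor I A\<^esub> q = 0" "p \<otimes>\<^bsub>free_tensor I A\<^esub> 0 = 0"
  by (simp_all add: free_tensor_mult_eq)

lemma free_tensor_mult_add [simp]:
  "(p + p') \<otimes>\<^bsub>free_tensor I A\<^esub> q = p \<otimes>\<^bsub>free_tensor I A\<^esub> q + p' \<otimes>\<^bsub>free_tensor I A\<^esub> q"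
  "p \<otimes>\<^bsub>free_tensor I A\<^esub> (q + q') = p \<otimes>\<^bsub>free_tensor I A\<^esub> q + p \<otimes>\<^bsub>free_tensor I A\<^esub> q'"
proof -
  show "(p + p') \<otimes>\<^bsub>free_tensor I A\<^esub> q = p \<otimes>\<^bsub>free_tensor I A\<^esub> q + p' \<otimes>\<^bsub>free_tensor I A\<^esub> q"
    unfolding free_tensor_mult_eq
    by (rule setsum_keys_plus_distrib[where f = "\<lambda>x a. \<Sum>y\<in>Poly_Mapping.keys q.
          Poly_Mapping.single (\<lambda>i\<in>I. x i \<otimes>\<^bsub>A i\<^esub> y i) (a * Poly_Mapping.lookup q y)"])
      (simp_all add: single_add distrib_right sum.distrib)
  have "(\<Sum>y\<in>Poly_Mapping.keys (q + q'). Poly_Mapping.single (\<lambda>i\<in>I. x i \<otimes>\<^bsub>A i\<^esub> y i) (a * Poly_Mapping.lookup (q + q') y))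
    = (\<Sum>y\<in>Poly_Mapping.keys q. Poly_Mapping.single (\<lambda>i\<in>I. x i \<otimes>\<^bsub>A i\<^esub> y i) (a * Poly_Mapping.lookup q y))
    + (\<Sum>y\<in>Poly_Mapping.keys q'. Poly_Mapping.single (\<lambda>i\<in>I. x i \<otimes>\<^bsub>A i\<^esub> y i) (a * Poly_Mapping.lookup q' y))" for x a
    by (rule setsum_keys_plus_distrib[where f = "\<lambda>y b. Poly_Mapping.single (\<lambda>i\<in>I. x i \<otimes>\<^bsub>A i\<^esub> y i) (a * b)"])
      (simp_all add: single_add distrib_left)
  then show "p \<otimes>\<^bsub>free_tensor I A\<^esub> (q + q') = p \<otimes>\<^bsub>free_tensor I A\<^esub> q + p \<otimes>\<^bsub>free_tensor I A\<^esub> q'"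
    by (simp add: free_tensor_mult_eq sum.distrib)
qed

lemma free_tensor_mult_diff [simp]:
  fixes p p' :: "('i \<Rightarrow> 'a) \<Rightarrow>\<^sub>0 'f::field"
  shows "(p - p') \<otimes>\<^bsub>free_tensor I A\<^esub> q = p \<otimes>\<^bsub>free_tensor I A\<^esub> q - p' \<otimes>\<^bsub>free_tensor I A\<^esub> q"
    and "q \<otimes>\<^bsub>free_tensor I A\<^esub> (p - p') = q \<otimes>\<^bsub>free_tensor I A\<^esub> p - q \<otimes>\<^bsub>free_tensor I A\<^esub> p'"
  using free_tensor_mult_add(1)[of I A "p - p'" p' q] free_tensor_mult_add(2)[of I A q "p - p'" p']
  by (simp_all add: algebra_simps)

lemma free_tensor_mult_scale [simp]:
  fixes p q :: "('i \<Rightarrow> 'a) \<Rightarrow>\<^sub>0 'f::field"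
  shows "Poly_Mapping.map ((*) c) p \<otimes>\<^bsub>free_tensor I A\<^esub> q = Poly_Mapping.map ((*) c) (p \<otimes>\<^bsub>free_tensor I A\<^esub> q)"
    and "p \<otimes>\<^bsub>free_tensor I A\<^esub> Poly_Mapping.map ((*) c) q = Poly_Mapping.map ((*) c) (p \<otimes>\<^bsub>free_tensor I A\<^esub> q)"
proof -
  have single: "Poly_Mapping.map ((*) c) (Poly_Mapping.single x d) \<otimes>\<^bsub>free_tensor I A\<^esub> q
      = Poly_Mapping.map ((*) c) (Poly_Mapping.single x d \<otimes>\<^bsub>free_tensor I A\<^esub> q)"
    "Poly_Mapping.single x d \<otimes>\<^bsub>free_tensor I A\<^esub> Poly_Mapping.map ((*) c) q
      = Poly_Mapping.map ((*) c) (Poly_Mapping.single x d \<otimes>\<^bsub>free_tensor I A\<^esub> q)" for x d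
    by (induction q rule: finitely_supported_induct[OF subset_UNIV]) (simp_all add: ac_simps)
  show "Poly_Mapping.map ((*) c) p \<otimes>\<^bsub>free_tensor I A\<^esub> q = Poly_Mapping.map ((*) c) (p \<otimes>\<^bsub>free_tensor I A\<^esub> q)"
    and "p \<otimes>\<^bsub>free_tensor I A\<^esub> Poly_Mapping.map ((*) c) q = Poly_Mapping.map ((*) c) (p \<otimes>\<^bsub>free_tensor I A\<^esub> q)"
    by (induction p rule: finitely_supported_induct[OF subset_UNIV]) (simp_all add: single del: map_single)
qed

locale algebra_family =
  fixes I :: "'i set" and A :: "'i \<Rightarrow> ('f::field, 'a) module"
  assumes factor: "i \<in> I \<Longrightarrow> unital_algebra (A i)"
begin

abbreviation "F \<equiv> free_tensor I A"
abbreviation "tuples \<equiv> \<Pi>\<^sub>E i\<in>I. carrier (A i)"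

lemma tuples_mem: "\<lbrakk>x \<in> tuples; i \<in> I\<rbrakk> \<Longrightarrow> x i \<in> carrier (A i)"
  by (rule PiE_mem)

lemma tuples_mult: "\<lbrakk>x \<in> tuples; y \<in> tuples\<rbrakk> \<Longrightarrow> (\<lambda>i\<in>I. x i \<otimes>\<^bsub>A i\<^esub> y i) \<in> tuples"
  by (intro restrict_PiE_iff[THEN iffD2] ballI ring.ring_simprules(5)[OF unital_algebraD(1)[OF factor]] tuples_mem)

lemma tuples_one: "(\<lambda>i\<in>I. \<one>\<^bsub>A i\<^esub>) \<in> tuples"
  by (intro restrict_PiE_iff[THEN iffD2] ballI ring.ring_simprules(6)[OF unital_algebraD(1)[OF factor]])

lemma free_tensor_mult_closed:
  "\<lbrakk>Poly_Mapping.keys p \<subseteq> tuples; Poly_Mapping.keys q \<subseteq> tuples\<rbrakk> \<Longrightarrow> Poly_Mapping.keys (p \<otimes>\<^bsub>F\<^esub> q) \<subseteq> tuples"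
proof (induction p rule: finitely_supported_induct)
  case (single x c)
  have keys: "Poly_Mapping.keys (Poly_Mapping.single x c \<otimes>\<^bsub>F\<^esub> Poly_Mapping.single y d) \<subseteq> tuples"
    if "y \<in> tuples" for y d
    unfolding free_tensor_mult_single keys_single using tuples_mult[OF \<open>x \<in> tuples\<close> that]
    by (cases "c * d = 0") (simp_all only: if_True if_False empty_subsetI insert_subset simp_thms)
  show ?case
    using single(2)
    by (induction q rule: finitely_supported_induct)
      (simp_all only: keys free_tensor_mult_add free_tensor_mult_zero free_tensor_closed keys_zero empty_subsetI)
qed (simp_all only: free_tensor_mult_add free_tensor_mult_zero free_tensor_closed keys_zero empty_subsetI)

lemma free_tensor_mult_assoc:
  assumes "Poly_Mapping.keys p \<subseteq> tuples" "Poly_Mapping.keys q \<subseteq> tuples" "Poly_Mapping.keys r \<subseteq> tuples"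
  shows "(p \<otimes>\<^bsub>F\<^esub> q) \<otimes>\<^bsub>F\<^esub> r = p \<otimes>\<^bsub>F\<^esub> (q \<otimes>\<^bsub>F\<^esub> r)"
proof -
  have tuples: "(\<lambda>i\<in>I. (\<lambda>i\<in>I. x i \<otimes>\<^bsub>A i\<^esub> y i) i \<otimes>\<^bsub>A i\<^esub> z i) = (\<lambda>i\<in>I. x i \<otimes>\<^bsub>A i\<^esub> (\<lambda>i\<in>I. y i \<otimes>\<^bsub>A i\<^esub> z i) i)"
    if "x \<in> tuples" "y \<in> tuples" "z \<in> tuples" for x y z
    using that by (intro restrict_ext) (simp add: tuples_mem ring.ring_simprules(11)[OF unital_algebraD(1)[OF factor]])
  have single2: "(Poly_Mapping.single x c \<otimes>\<^bsub>F\<^esub> Poly_Mapping.single y d) \<otimes>\<^bsub>F\<^esub> r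
      = Poly_Mapping.single x c \<otimes>\<^bsub>F\<^esub> (Poly_Mapping.single y d \<otimes>\<^bsub>F\<^esub> r)"
    if "x \<in> tuples" "y \<in> tuples" for x c y d
    using assms(3)
    by (induction r rule: finitely_supported_induct) (simp_all add: tuples[OF that] ac_simps del: restrict_apply)
  have single: "(Poly_Mapping.single x c \<otimes>\<^bsub>F\<^esub> q) \<otimes>\<^bsub>F\<^esub> r = Poly_Mapping.single x c \<otimes>\<^bsub>F\<^esub> (q \<otimes>\<^bsub>F\<^esub> r)"
    if "x \<in> tuples" for x c
    using assms(2)
    by (induction q rule: finitely_supported_induct)
      (simp_all only: single2[OF that] free_tensor_mult_add free_tensor_mult_zero)
  show ?thesis
    using assms(1)
    by (induction p rule: finitely_supported_induct) (simp_all add: single)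
qed

lemma free_tensor_mult_one:
  assumes "Poly_Mapping.keys p \<subseteq> tuples"
  shows "\<one>\<^bsub>F\<^esub> \<otimes>\<^bsub>F\<^esub> p = p" "p \<otimes>\<^bsub>F\<^esub> \<one>\<^bsub>F\<^esub> = p"
proof -
  have "(\<lambda>i\<in>I. (\<lambda>i\<in>I. \<one>\<^bsub>A i\<^esub>) i \<otimes>\<^bsub>A i\<^esub> x i) = x" "(\<lambda>i\<in>I. x i \<otimes>\<^bsub>A i\<^esub> (\<lambda>i\<in>I. \<one>\<^bsub>A i\<^esub>) i) = x"
    if x: "x \<in> tuples" for x
    by (rule extensionalityI[where A = I];
        use x in \<open>simp add: tuples_mem PiE_iff monoid.l_one[OF ring.is_monoid[OF unital_algebraD(1)[OF factor]]]
          monoid.r_one[OF ring.is_monoid[OF unital_algebraD(1)[OF factor]]]\<close>)+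
  with assms show "\<one>\<^bsub>F\<^esub> \<otimes>\<^bsub>F\<^esub> p = p" "p \<otimes>\<^bsub>F\<^esub> \<one>\<^bsub>F\<^esub> = p"
    by (induction p rule: finitely_supported_induct) (simp_all del: restrict_apply)
qed

lemma unital_algebra_free_tensor: "unital_algebra F"
proof (rule unital_algebraI)
  show "abelian_group F"
  proof (rule abelian_groupI)
    fix p assume "p \<in> carrier F"
    then have "Poly_Mapping.keys (0 - p) \<subseteq> tuples"
      by (intro free_tensor_closed(2)) auto
    then show "\<exists>q\<in>carrier F. q \<oplus>\<^bsub>F\<^esub> p = \<zero>\<^bsub>F\<^esub>"
      by (intro bexI[of _ "- p"]) simp_all
  qed (simp_all add: algebra_simps)
  show "Group.monoid F"
  proof (rule monoidI)
    show "\<one>\<^bsub>F\<^esub> \<in> carrier F"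
      using tuples_one by (simp del: restrict_PiE_iff)
  qed (simp_all only: free_tensor_simps mem_Collect_eq free_tensor_mult_closed free_tensor_mult_assoc
      free_tensor_mult_one[unfolded free_tensor_simps])
qed (simp_all add: scale_add_left scale_scale)

end

section \<open>Tensor products of algebras\<close>

abbreviation tensor_class ::
  "'i set \<Rightarrow> ('i \<Rightarrow> ('f::field, 'a) module) \<Rightarrow> (('i \<Rightarrow> 'a) \<Rightarrow>\<^sub>0 'f) \<Rightarrow> (('i \<Rightarrow> 'a) \<Rightarrow>\<^sub>0 'f) set" where
  "tensor_class I A p \<equiv> tensor_null I A +>\<^bsub>free_tensor I A\<^esub> p"

text \<open>
  The map on tuples whose linear extension induces \<^const>\<open>fill_units\<close>.
\<close>

definition fill_tuple :: "('i \<Rightarrow> ('f::field, 'a) module) \<Rightarrow> 'i set \<Rightarrow> 'i set \<Rightarrow> ('i \<Rightarrow> 'a) \<Rightarrow> 'i \<Rightarrow> 'a" where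
  "fill_tuple A J I x = (\<lambda>i\<in>I. if i \<in> J then x i else \<one>\<^bsub>A i\<^esub>)"

lemma fill_units_eq: "fill_units A J I X = (\<Union>p\<in>X. tensor_class I A (lin_ext (fill_tuple A J I) p))"
  by (simp add: fill_units_def lin_ext_def fill_tuple_def)

context algebra_family
begin

abbreviation "N \<equiv> tensor_null I A"

lemma tuples_upd: "\<lbrakk>x \<in> tuples; i \<in> I; a \<in> carrier (A i)\<rbrakk> \<Longrightarrow> x(i := a) \<in> tuples"
  using PiE_fun_upd[of a "\<lambda>i. carrier (A i)" i x I] by (simp add: insert_absorb)

lemma keys_single_upd:
  "\<lbrakk>x \<in> tuples; i \<in> I; a \<in> carrier (A i)\<rbrakk> \<Longrightarrow> Poly_Mapping.keys (Poly_Mapping.single (x(i := a)) c) \<subseteq> tuples"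
  using tuples_upd[of x i a] by (simp del: fun_upd_apply)

lemma tensor_relations_closed: "tensor_relations I A \<subseteq> carrier F"
proof
  fix r assume "r \<in> tensor_relations I A"
  then consider
      (sum) x i a b where "x \<in> tuples" "i \<in> I" "a \<in> carrier (A i)" "b \<in> carrier (A i)"
        "r = Poly_Mapping.single (x(i := a \<oplus>\<^bsub>A i\<^esub> b)) 1
          - Poly_Mapping.single (x(i := a)) 1 - Poly_Mapping.single (x(i := b)) 1"
    | (scale) x i c a where "x \<in> tuples" "i \<in> I" "a \<in> carrier (A i)"
        "r = Poly_Mapping.single (x(i := c \<odot>\<^bsub>A i\<^esub> a)) 1 - Poly_Mapping.single (x(i := a)) c"
    unfolding tensor_relations_def by blast
  then have "Poly_Mapping.keys r \<subseteq> tuples"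
  proof cases
    case sum
    then show ?thesis
      by (simp only: sum(5))
        (intro free_tensor_closed(2) keys_single_upd ring.ring_simprules(1)[OF unital_algebraD(1)[OF factor]])
  next
    case scale
    then show ?thesis
      by (simp only: scale(4))
        (intro free_tensor_closed(2) keys_single_upd unital_algebra_smult(1)[OF factor])
  qed
  then show "r \<in> carrier F" by simp
qed

lemma tensor_null_submodule: "LinearCombinations.submodule class_ring N F"
  unfolding tensor_null_def
  by (rule module.span_is_submodule[OF unital_algebraD(2)[OF unital_algebra_free_tensor] tensor_relations_closed])

lemma tensor_relations_null: "tensor_relations I A \<subseteq> N"
  unfolding tensor_null_def
  by (rule module.in_own_span[OF unital_algebraD(2)[OF unital_algebra_free_tensor] tensor_relations_closed])

lemma tensor_null_closed:
  "p \<in> N \<Longrightarrow> Poly_Mapping.keys p \<subseteq> tuples"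
  "0 \<in> N"
  "\<lbrakk>p \<in> N; q \<in> N\<rbrakk> \<Longrightarrow> p + q \<in> N"
  "p \<in> N \<Longrightarrow> Poly_Mapping.map ((*) c) p \<in> N"
  using tensor_null_submodule unfolding LinearCombinations.submodule_def by auto

lemma tensor_null_diff: "\<lbrakk>p \<in> N; q \<in> N\<rbrakk> \<Longrightarrow> p - q \<in> N"
proof -
  assume "p \<in> N" "q \<in> N"
  then have "p + Poly_Mapping.map ((*) (- 1)) q \<in> N"
    by (intro tensor_null_closed)
  moreover have "p + Poly_Mapping.map ((*) (- 1)) q = p - q"
    by (intro poly_mapping_eqI) (simp add: lookup_scale lookup_add lookup_minus)
  ultimately show ?thesis by simp
qed

lemma tensor_null_relations:
  assumes "x \<in> tuples" "i \<in> I" "a \<in> carrier (A i)"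
  shows "b \<in> carrier (A i) \<Longrightarrow> Poly_Mapping.single (x(i := a \<oplus>\<^bsub>A i\<^esub> b)) 1
      - Poly_Mapping.single (x(i := a)) 1 - Poly_Mapping.single (x(i := b)) 1 \<in> N"
    and "Poly_Mapping.single (x(i := c \<odot>\<^bsub>A i\<^esub> a)) 1 - Poly_Mapping.single (x(i := a)) c \<in> N"
  using assms tensor_relations_null unfolding tensor_relations_def by blast+

text \<open>
  The span is the smallest submodule that contains the relations, and the elements of the span that
  satisfy \<open>P\<close> form a submodule.
\<close>

lemma tensor_null_induct [consumes 1, case_names zero add scale sum_relation scale_relation]:
  assumes p: "p \<in> N"
    and zero: "P 0"
    and add: "\<And>p q. \<lbrakk>p \<in> N; q \<in> N; P p; P q\<rbrakk> \<Longrightarrow> P (p + q)"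
    and scale: "\<And>c p. \<lbrakk>p \<in> N; P p\<rbrakk> \<Longrightarrow> P (Poly_Mapping.map ((*) c) p)"
    and sum_relation: "\<And>x i a b. \<lbrakk>x \<in> tuples; i \<in> I; a \<in> carrier (A i); b \<in> carrier (A i)\<rbrakk> \<Longrightarrow>
      P (Poly_Mapping.single (x(i := a \<oplus>\<^bsub>A i\<^esub> b)) 1
        - Poly_Mapping.single (x(i := a)) 1 - Poly_Mapping.single (x(i := b)) 1)"
    and scale_relation: "\<And>x i a c. \<lbrakk>x \<in> tuples; i \<in> I; a \<in> carrier (A i)\<rbrakk> \<Longrightarrow>
      P (Poly_Mapping.single (x(i := c \<odot>\<^bsub>A i\<^esub> a)) 1 - Poly_Mapping.single (x(i := a)) c)"
  shows "P p"
proof -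
  have sub: "LinearCombinations.submodule class_ring {p \<in> N. P p} F"
    using tensor_null_closed zero add scale unital_algebraD(2)[OF unital_algebra_free_tensor]
    by (intro LinearCombinations.submodule.intro) auto
  have "tensor_relations I A \<subseteq> {p \<in> N. P p}"
  proof
    fix r assume r: "r \<in> tensor_relations I A"
    then have "r \<in> N"
      using tensor_relations_null by blast
    moreover have "P r"
      using r sum_relation scale_relation unfolding tensor_relations_def by blast
    ultimately show "r \<in> {p \<in> N. P p}" by blast
  qed
  then have "N \<subseteq> {p \<in> N. P p}"
    using module.span_is_subset[OF unital_algebraD(2)[OF unital_algebra_free_tensor] _ sub]
    by (simp add: tensor_null_def)
  with p show ?thesis by blast
qed

lemma tuple_mult_upd:
  "(\<lambda>j\<in>I. (x(i := a)) j \<otimes>\<^bsub>A j\<^esub> y j) = (if i \<in> I then (\<lambda>j\<in>I. x j \<otimes>\<^bsub>A j\<^esub> y j)(i := a \<otimes>\<^bsub>A i\<^esub> y i) else (\<lambda>j\<in>I. x j \<otimes>\<^bsub>A j\<^esub> y j))"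
  "(\<lambda>j\<in>I. y j \<otimes>\<^bsub>A j\<^esub> (x(i := a)) j) = (if i \<in> I then (\<lambda>j\<in>I. y j \<otimes>\<^bsub>A j\<^esub> x j)(i := y i \<otimes>\<^bsub>A i\<^esub> a) else (\<lambda>j\<in>I. y j \<otimes>\<^bsub>A j\<^esub> x j))"
  by (auto simp: fun_eq_iff restrict_def)

text \<open>A multilinearity relation multiplied by a tuple is a multiple of a multilinearity relation.\<close>

lemma tensor_null_mult_single:
  assumes p: "p \<in> N" and y: "y \<in> tuples"
  shows "p \<otimes>\<^bsub>F\<^esub> Poly_Mapping.single y c \<in> N" "Poly_Mapping.single y c \<otimes>\<^bsub>F\<^esub> p \<in> N"
proof -
  have y1: "p \<otimes>\<^bsub>F\<^esub> Poly_Mapping.single y 1 \<in> N \<and> Poly_Mapping.single y 1 \<otimes>\<^bsub>F\<^esub> p \<in> N"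
    using p
  proof (induction p rule: tensor_null_induct)
    case (sum_relation x i a b)
    then have yi: "y i \<in> carrier (A i)" and ring: "ring (A i)"
      using y tuples_mem unital_algebraD(1)[OF factor] by auto
    note closed = ring.ring_simprules(5)[OF ring]
    show ?case
      using sum_relation yi tensor_null_relations(1)[OF tuples_mult[OF sum_relation(1) y] sum_relation(2)
          closed[OF sum_relation(3) yi] closed[OF sum_relation(4) yi]]
        tensor_null_relations(1)[OF tuples_mult[OF y sum_relation(1)] sum_relation(2)
          closed[OF yi sum_relation(3)] closed[OF yi sum_relation(4)]]
      by (simp add: tuple_mult_upd ring.ring_simprules(13,23)[OF ring] del: fun_upd_apply restrict_apply)
  next
    case (scale_relation x i a d)
    then have yi: "y i \<in> carrier (A i)" and ring: "ring (A i)" and alg: "unital_algebra (A i)"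
      using y tuples_mem factor unital_algebraD(1)[OF factor] by auto
    note closed = ring.ring_simprules(5)[OF ring]
    show ?case
      using scale_relation yi tensor_null_relations(2)[OF tuples_mult[OF scale_relation(1) y] scale_relation(2)
          closed[OF scale_relation(3) yi]]
        tensor_null_relations(2)[OF tuples_mult[OF y scale_relation(1)] scale_relation(2)
          closed[OF yi scale_relation(3)]]
      by (simp add: tuple_mult_upd unital_algebraD(3,4)[OF alg] del: fun_upd_apply restrict_apply)
  qed (simp_all add: tensor_null_closed)
  have "Poly_Mapping.single y c = Poly_Mapping.map ((*) c) (Poly_Mapping.single y 1)"
    by simp
  then show "p \<otimes>\<^bsub>F\<^esub> Poly_Mapping.single y c \<in> N" "Poly_Mapping.single y c \<otimes>\<^bsub>F\<^esub> p \<in> N"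
    using y1 by (simp_all only: free_tensor_mult_scale tensor_null_closed(4))
qed

lemma tensor_null_ideal:
  assumes "p \<in> N" "Poly_Mapping.keys q \<subseteq> tuples"
  shows "p \<otimes>\<^bsub>F\<^esub> q \<in> N" "q \<otimes>\<^bsub>F\<^esub> p \<in> N"
  using assms(2)
  by (induction q rule: finitely_supported_induct)
    (simp_all add: tensor_null_closed tensor_null_mult_single[OF assms(1)])

lemma mem_tensor_class: "q \<in> tensor_class I A p \<longleftrightarrow> q - p \<in> N"
  unfolding a_r_coset_def r_coset_def by (auto intro!: bexI[of _ "q - p"])

lemma tensor_class_self: "p \<in> tensor_class I A p"
  by (simp add: mem_tensor_class tensor_null_closed)

lemma tensor_class_eqI: "q - p \<in> N \<Longrightarrow> tensor_class I A q = tensor_class I A p"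
proof -
  assume qp: "q - p \<in> N"
  have "r - q \<in> N \<longleftrightarrow> r - p \<in> N" for r
    using tensor_null_closed(3)[OF _ qp, of "r - q"] tensor_null_diff[OF _ qp, of "r - p"] by auto
  then show ?thesis
    by (simp add: set_eq_iff mem_tensor_class)
qed

lemma mem_tensor_class_keys:
  assumes "Poly_Mapping.keys p \<subseteq> tuples" "q \<in> tensor_class I A p"
  shows "Poly_Mapping.keys q \<subseteq> tuples"
proof -
  have "Poly_Mapping.keys (p + (q - p)) \<subseteq> tuples"
    using assms by (intro free_tensor_closed(1)) (simp_all add: mem_tensor_class tensor_null_closed(1))
  then show ?thesis by simp
qed

lemma UN_tensor_class:
  assumes "\<And>q. q \<in> tensor_class I A p \<Longrightarrow> g q = G"
  shows "(\<Union>q\<in>tensor_class I A p. g q) = G"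
  using assms tensor_class_self[of p] by auto

lemma carrier_tensor_product:
  "carrier (tensor_product I A) = tensor_class I A ` {p. Poly_Mapping.keys p \<subseteq> tuples}"
  by (auto simp: tensor_product_def ring.defs module.defs FactRing_def A_RCOSETS_def' )

lemma tensor_class_mult:
  assumes "Poly_Mapping.keys p \<subseteq> tuples" "Poly_Mapping.keys q \<subseteq> tuples"
  shows "tensor_class I A p \<otimes>\<^bsub>tensor_product I A\<^esub> tensor_class I A q = tensor_class I A (p \<otimes>\<^bsub>F\<^esub> q)"
proof -
  have "tensor_class I A (a \<otimes>\<^bsub>F\<^esub> b) = tensor_class I A (p \<otimes>\<^bsub>F\<^esub> q)"
    if ab: "a \<in> tensor_class I A p" "b \<in> tensor_class I A q" for a b
  proof (rule tensor_class_eqI)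
    \<comment> \<open>The difference of the products telescopes into two elements of the ideal.\<close>
    have "(a - p) \<otimes>\<^bsub>F\<^esub> b + p \<otimes>\<^bsub>F\<^esub> (b - q) \<in> N"
      using assms ab mem_tensor_class_keys[OF _ ab(2)]
      by (intro tensor_null_closed(3) tensor_null_ideal) (simp_all add: mem_tensor_class)
    then show "a \<otimes>\<^bsub>F\<^esub> b - p \<otimes>\<^bsub>F\<^esub> q \<in> N" by simp
  qed
  then have "(\<Union>a\<in>tensor_class I A p. \<Union>b\<in>tensor_class I A q. tensor_class I A (a \<otimes>\<^bsub>F\<^esub> b))
      = tensor_class I A (p \<otimes>\<^bsub>F\<^esub> q)"
    by (intro UN_tensor_class)
  then show ?thesis
    by (simp add: tensor_product_def ring.defs module.defs FactRing_def rcoset_mult_def)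
qed

lemma tensor_class_add:
  "tensor_class I A p \<oplus>\<^bsub>tensor_product I A\<^esub> tensor_class I A q = tensor_class I A (p + q)"
proof -
  have "set_add F (tensor_class I A p) (tensor_class I A q) = {a + b | a b. a - p \<in> N \<and> b - q \<in> N}"
    unfolding set_add_def set_mult_def by (simp add: mem_tensor_class[symmetric]) blast
  also have "\<dots> = tensor_class I A (p + q)"
  proof (intro equalityI subsetI)
    fix r assume "r \<in> {a + b | a b. a - p \<in> N \<and> b - q \<in> N}"
    then obtain a b where ab: "a - p \<in> N" "b - q \<in> N" "r = a + b" by blast
    then show "r \<in> tensor_class I A (p + q)"
      using tensor_null_closed(3)[OF ab(1,2)] by (simp add: mem_tensor_class add_diff_add)
  next
    fix r assume "r \<in> tensor_class I A (p + q)"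
    then have "(r - q) - p \<in> N" "q - q \<in> N" "r = (r - q) + q"
      by (simp_all add: mem_tensor_class algebra_simps tensor_null_closed)
    then show "r \<in> {a + b | a b. a - p \<in> N \<and> b - q \<in> N}" by blast
  qed
  finally have "set_add F (tensor_class I A p) (tensor_class I A q) = tensor_class I A (p + q)" .
  then show ?thesis
    by (simp add: tensor_product_def ring.defs module.defs FactRing_def)
qed

lemma tensor_class_smult:
  "c \<odot>\<^bsub>tensor_product I A\<^esub> tensor_class I A p = tensor_class I A (Poly_Mapping.map ((*) c) p)"
proof -
  have "tensor_class I A (Poly_Mapping.map ((*) c) q) = tensor_class I A (Poly_Mapping.map ((*) c) p)"
    if "q \<in> tensor_class I A p" for q
    using that tensor_null_closed(4)[of "q - p" c]
    by (intro tensor_class_eqI) (simp add: mem_tensor_class)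
  then have "(\<Union>q\<in>tensor_class I A p. tensor_class I A (Poly_Mapping.map ((*) c) q))
      = tensor_class I A (Poly_Mapping.map ((*) c) p)"
    by (intro UN_tensor_class)
  then show ?thesis
    by (simp add: tensor_product_def ring.defs module.defs)
qed

lemma tensor_class_hom: "tensor_class I A \<in> alg_hom F (tensor_product I A)"
proof (rule alg_homI)
  show "tensor_class I A \<one>\<^bsub>F\<^esub> = \<one>\<^bsub>tensor_product I A\<^esub>"
    by (simp add: tensor_product_def ring.defs module.defs FactRing_def)
qed (simp_all add: carrier_tensor_product tensor_class_mult tensor_class_add tensor_class_smult)

lemma tensor_class_zero: "tensor_class I A 0 = \<zero>\<^bsub>tensor_product I A\<^esub>"
  by (auto simp: tensor_product_def ring.defs module.defs FactRing_def mem_tensor_class)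

lemma unital_algebra_tensor_product: "unital_algebra (tensor_product I A)"
proof (rule unital_algebra_directed_image[where A = "\<lambda>_. F" and f = "\<lambda>_. tensor_class I A"])
  show "unital_algebra F"
    by (rule unital_algebra_free_tensor)
qed (simp_all add: tensor_class_hom tensor_class_zero carrier_tensor_product)

end

subsection \<open>Filling in units\<close>

lemma fill_tuple_id: "x \<in> extensional I \<Longrightarrow> fill_tuple A I I x = x"
  by (rule ext) (simp add: fill_tuple_def restrict_def extensional_def)

lemma fill_tuple_fill_tuple:
  "\<lbrakk>J \<subseteq> K; K \<subseteq> I\<rbrakk> \<Longrightarrow> fill_tuple A K I (fill_tuple A J K x) = fill_tuple A J I x"
  by (auto simp: fill_tuple_def fun_eq_iff)

context algebra_family
begin

lemma fill_tuple_tuples: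
  assumes "J \<subseteq> I" "x \<in> (\<Pi>\<^sub>E i\<in>J. carrier (A i))"
  shows "fill_tuple A J I x \<in> tuples"
proof -
  have "(if i \<in> J then x i else \<one>\<^bsub>A i\<^esub>) \<in> carrier (A i)" if "i \<in> I" for i
    using that assms PiE_mem[OF assms(2)] ring.ring_simprules(6)[OF unital_algebraD(1)[OF factor]] by simp
  then show ?thesis
    unfolding fill_tuple_def by simp
qed

lemma subfamily: "J \<subseteq> I \<Longrightarrow> algebra_family J A"
  using factor by (auto intro: algebra_family.intro)

lemma keys_fill:
  assumes "J \<subseteq> I" "Poly_Mapping.keys p \<subseteq> (\<Pi>\<^sub>E i\<in>J. carrier (A i))"
  shows "Poly_Mapping.keys (lin_ext (fill_tuple A J I) p) \<subseteq> tuples"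
  using assms(2) by (rule keys_lin_ext_subset) (use fill_tuple_tuples[OF assms(1)] in blast)

text \<open>
  Changing an entry of a tuple commutes with filling in units, so relations go to relations and
  \<^const>\<open>fill_units\<close> is well defined on classes.
\<close>

lemma fill_null:
  assumes J: "J \<subseteq> I" and p: "p \<in> tensor_null J A"
  shows "lin_ext (fill_tuple A J I) p \<in> N"
proof -
  interpret J: algebra_family J A
    using J by (rule subfamily)
  have upd: "fill_tuple A J I (x(i := a)) = (fill_tuple A J I x)(i := a)" if "i \<in> J" for x i a
    using that J by (auto simp: fill_tuple_def fun_eq_iff)
  show ?thesis
    using p
  proof (induction p rule: J.tensor_null_induct)
    case (sum_relation x i a b)
    then show ?case
      using tensor_null_relations(1)[OF fill_tuple_tuples[OF J, of x], of i a b] J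
      by (auto simp: upd simp del: fun_upd_apply)
  next
    case (scale_relation x i a c)
    then show ?case
      using tensor_null_relations(2)[OF fill_tuple_tuples[OF J, of x], of i a c] J
      by (auto simp: upd simp del: fun_upd_apply)
  qed (simp_all add: tensor_null_closed)
qed

lemma fill_units_tensor_class:
  assumes J: "J \<subseteq> I"
  shows "fill_units A J I (tensor_class J A p) = tensor_class I A (lin_ext (fill_tuple A J I) p)"
proof -
  interpret J: algebra_family J A
    using J by (rule subfamily)
  show ?thesis
    unfolding fill_units_eq
  proof (rule J.UN_tensor_class)
    fix q assume "q \<in> tensor_class J A p"
    then show "tensor_class I A (lin_ext (fill_tuple A J I) q) = tensor_class I A (lin_ext (fill_tuple A J I) p)"
      using fill_null[OF J, of "q - p"] by (intro tensor_class_eqI) (simp add: J.mem_tensor_class)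
  qed
qed

lemma lin_ext_fill_mult:
  assumes J: "J \<subseteq> I"
  shows "lin_ext (fill_tuple A J I) (p \<otimes>\<^bsub>free_tensor J A\<^esub> q)
    = lin_ext (fill_tuple A J I) p \<otimes>\<^bsub>F\<^esub> lin_ext (fill_tuple A J I) q"
proof -
  have tuple: "fill_tuple A J I (\<lambda>i\<in>J. x i \<otimes>\<^bsub>A i\<^esub> y i)
      = (\<lambda>i\<in>I. fill_tuple A J I x i \<otimes>\<^bsub>A i\<^esub> fill_tuple A J I y i)" for x y
    using monoid.l_one[OF ring.is_monoid[OF unital_algebraD(1)[OF factor]]]
      monoid.one_closed[OF ring.is_monoid[OF unital_algebraD(1)[OF factor]]]
    by (auto simp: fill_tuple_def fun_eq_iff)
  have single: "lin_ext (fill_tuple A J I) (Poly_Mapping.single x c \<otimes>\<^bsub>free_tensor J A\<^esub> q)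
      = Poly_Mapping.single (fill_tuple A J I x) c \<otimes>\<^bsub>F\<^esub> lin_ext (fill_tuple A J I) q" for x c
    by (induction q rule: finitely_supported_induct[OF subset_UNIV]) (simp_all add: tuple del: restrict_apply)
  show ?thesis
    by (induction p rule: finitely_supported_induct[OF subset_UNIV]) (simp_all add: single)
qed

lemma fill_units_hom:
  assumes J: "J \<subseteq> I"
  shows "fill_units A J I \<in> alg_hom (tensor_product J A) (tensor_product I A)"
proof -
  interpret J: algebra_family J A
    using J by (rule subfamily)
  note simps = fill_units_tensor_class[OF J] J.tensor_class_add J.tensor_class_mult J.tensor_class_smult
    tensor_class_add tensor_class_mult tensor_class_smult keys_fill[OF J] lin_ext_fill_mult[OF J]
  show ?thesis
  proof (rule alg_homI)
    fix X assume "X \<in> carrier (tensor_product J A)"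
    then obtain p where p: "X = tensor_class J A p" "Poly_Mapping.keys p \<subseteq> (\<Pi>\<^sub>E i\<in>J. carrier (A i))"
      unfolding J.carrier_tensor_product by blast
    then show "fill_units A J I X \<in> carrier (tensor_product I A)"
      by (simp add: simps carrier_tensor_product)
    show "fill_units A J I (c \<odot>\<^bsub>tensor_product J A\<^esub> X) = c \<odot>\<^bsub>tensor_product I A\<^esub> fill_units A J I X" for c
      using p by (simp add: simps)
    fix Y assume "Y \<in> carrier (tensor_product J A)"
    then obtain q where q: "Y = tensor_class J A q" "Poly_Mapping.keys q \<subseteq> (\<Pi>\<^sub>E i\<in>J. carrier (A i))"
      unfolding J.carrier_tensor_product by blast
    show "fill_units A J I (X \<oplus>\<^bsub>tensor_product J A\<^esub> Y)
        = fill_units A J I X \<oplus>\<^bsub>tensor_product I A\<^esub> fill_units A J I Y"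
      and "fill_units A J I (X \<otimes>\<^bsub>tensor_product J A\<^esub> Y)
        = fill_units A J I X \<otimes>\<^bsub>tensor_product I A\<^esub> fill_units A J I Y"
      using p q by (simp_all add: simps)
  next
    have "fill_tuple A J I (\<lambda>i\<in>J. \<one>\<^bsub>A i\<^esub>) = (\<lambda>i\<in>I. \<one>\<^bsub>A i\<^esub>)"
      by (auto simp: fill_tuple_def fun_eq_iff)
    then have "fill_units A J I (tensor_class J A \<one>\<^bsub>free_tensor J A\<^esub>) = tensor_class I A \<one>\<^bsub>F\<^esub>"
      by (simp add: fill_units_tensor_class[OF J] del: restrict_apply)
    then show "fill_units A J I \<one>\<^bsub>tensor_product J A\<^esub> = \<one>\<^bsub>tensor_product I A\<^esub>"
      by (simp only: alg_homD(5)[OF tensor_class_hom] alg_homD(5)[OF J.tensor_class_hom])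
  qed
qed

text \<open>
  In each position one of the two entries is a unit, so tuples supported on disjoint index sets
  commute.
\<close>

lemma fill_mult_commute:
  assumes J: "J \<subseteq> I" and K: "K \<subseteq> I" and disjoint: "J \<inter> K = {}"
    and p: "Poly_Mapping.keys p \<subseteq> (\<Pi>\<^sub>E i\<in>J. carrier (A i))"
    and q: "Poly_Mapping.keys q \<subseteq> (\<Pi>\<^sub>E i\<in>K. carrier (A i))"
  shows "lin_ext (fill_tuple A J I) p \<otimes>\<^bsub>F\<^esub> lin_ext (fill_tuple A K I) q
    = lin_ext (fill_tuple A K I) q \<otimes>\<^bsub>F\<^esub> lin_ext (fill_tuple A J I) p"
proof -
  have tuple: "(\<lambda>i\<in>I. fill_tuple A J I x i \<otimes>\<^bsub>A i\<^esub> fill_tuple A K I y i)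
      = (\<lambda>i\<in>I. fill_tuple A K I y i \<otimes>\<^bsub>A i\<^esub> fill_tuple A J I x i)"
    if "x \<in> (\<Pi>\<^sub>E i\<in>J. carrier (A i))" "y \<in> (\<Pi>\<^sub>E i\<in>K. carrier (A i))" for x y
  proof (rule restrict_ext)
    fix i assume i: "i \<in> I"
    interpret ring "A i"
      using i by (intro unital_algebraD(1) factor)
    have "fill_tuple A J I x i \<in> carrier (A i)" "fill_tuple A K I y i \<in> carrier (A i)"
      using i that by (auto intro!: tuples_mem fill_tuple_tuples J K)
    moreover have "fill_tuple A J I x i = \<one>\<^bsub>A i\<^esub> \<or> fill_tuple A K I y i = \<one>\<^bsub>A i\<^esub>"
      using i disjoint by (auto simp: fill_tuple_def)
    ultimately show "fill_tuple A J I x i \<otimes>\<^bsub>A i\<^esub> fill_tuple A K I y i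
        = fill_tuple A K I y i \<otimes>\<^bsub>A i\<^esub> fill_tuple A J I x i"
      by auto
  qed
  have single: "Poly_Mapping.single (fill_tuple A J I x) c \<otimes>\<^bsub>F\<^esub> lin_ext (fill_tuple A K I) q
      = lin_ext (fill_tuple A K I) q \<otimes>\<^bsub>F\<^esub> Poly_Mapping.single (fill_tuple A J I x) c"
    if "x \<in> (\<Pi>\<^sub>E i\<in>J. carrier (A i))" for x c
    using q
    by (induction q rule: finitely_supported_induct) (simp_all add: tuple[OF that] mult.commute del: restrict_apply)
  show ?thesis
    using p by (induction p rule: finitely_supported_induct) (simp_all add: single)
qed

end

section \<open>Direct limits\<close>

locale directed_system =
  fixes B :: "nat \<Rightarrow> ('f::field, 'b) module" and h :: "nat \<Rightarrow> nat \<Rightarrow> 'b \<Rightarrow> 'b"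
  assumes stage: "unital_algebra (B m)"
    and map_hom: "m \<le> k \<Longrightarrow> h m k \<in> alg_hom (B m) (B k)"
    and map_id: "x \<in> carrier (B m) \<Longrightarrow> h m m x = x"
    and map_comp: "\<lbrakk>m \<le> k; k \<le> l; x \<in> carrier (B m)\<rbrakk> \<Longrightarrow> h k l (h m k x) = h m l x"
begin

lemma map_closed: "\<lbrakk>m \<le> k; x \<in> carrier (B m)\<rbrakk> \<Longrightarrow> h m k x \<in> carrier (B k)"
  using alg_homD(1)[OF map_hom] .

lemma dirlim_rel_mono:
  assumes "m \<le> l" "k \<le> l" "l \<le> l'" "x \<in> carrier (B m)" "y \<in> carrier (B k)" "h m l x = h k l y"
  shows "h m l' x = h k l' y"
  using assms map_comp[of m l l' x] map_comp[of k l l' y] by simp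

text \<open>
  Transitivity needs two witnessing stages to be replaced by their maximum, which
  \<open>dirlim_rel_mono\<close> permits.
\<close>

lemma equiv_dirlim_rel: "equiv (SIGMA m:UNIV. carrier (B m)) (dirlim_rel B h)"
proof (rule equivI)
  show "dirlim_rel B h \<subseteq> (SIGMA m:UNIV. carrier (B m)) \<times> (SIGMA m:UNIV. carrier (B m))"
    by (auto simp: dirlim_rel_def)
  show "refl_on (SIGMA m:UNIV. carrier (B m)) (dirlim_rel B h)"
    by (auto simp: dirlim_rel_def refl_on_def)
  show "sym (dirlim_rel B h)"
    by (force simp: dirlim_rel_def sym_def)
  show "trans (dirlim_rel B h)"
  proof (rule transI)
    fix X Y Z assume XY: "(X, Y) \<in> dirlim_rel B h" and YZ: "(Y, Z) \<in> dirlim_rel B h"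
    from XY obtain m x k y l where 1: "X = (m, x)" "Y = (k, y)" "x \<in> carrier (B m)" "y \<in> carrier (B k)"
        "m \<le> l" "k \<le> l" "h m l x = h k l y"
      by (auto simp: dirlim_rel_def)
    from YZ 1(2) obtain n z l' where 2: "Z = (n, z)" "z \<in> carrier (B n)"
        "k \<le> l'" "n \<le> l'" "h k l' y = h n l' z"
      by (auto simp: dirlim_rel_def)
    have "h m (max l l') x = h k (max l l') y"
      by (rule dirlim_rel_mono[OF 1(5,6) _ 1(3,4,7)]) simp
    also have "\<dots> = h n (max l l') z"
      by (rule dirlim_rel_mono[OF 2(3,4) _ 1(4) 2(2,5)]) simp
    finally show "(X, Z) \<in> dirlim_rel B h"
      using 1(1,3,5) 2(1,2,4) by (auto simp: dirlim_rel_def intro!: exI[of _ "max l l'"])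
  qed
qed

abbreviation cls :: "nat \<Rightarrow> 'b \<Rightarrow> (nat \<times> 'b) set" where
  "cls m x \<equiv> dirlim_class B h m x"

lemma mem_dirlim_class:
  "x \<in> carrier (B m) \<Longrightarrow> (k, y) \<in> cls m x \<longleftrightarrow>
     y \<in> carrier (B k) \<and> (\<exists>l. m \<le> l \<and> k \<le> l \<and> h m l x = h k l y)"
  by (auto simp: dirlim_class_def dirlim_rel_def)

lemma dirlim_class_eqI:
  assumes "x \<in> carrier (B m)" "y \<in> carrier (B k)" "m \<le> l" "k \<le> l" "h m l x = h k l y"
  shows "cls m x = cls k y"
  unfolding dirlim_class_def
  by (rule equiv_class_eq[OF equiv_dirlim_rel]) (use assms in \<open>auto simp: dirlim_rel_def\<close>)

lemma dirlim_class_push: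
  assumes "m \<le> k" "x \<in> carrier (B m)"
  shows "cls k (h m k x) = cls m x"
  using assms map_comp[of m k k x] map_closed[of m k x]
  by (intro dirlim_class_eqI[of _ k _ m k]) auto

lemma carrier_dirlim: "carrier (dirlim B h) = (\<Union>m. cls m ` carrier (B m))"
  by (auto simp: dirlim_def quotient_def dirlim_class_def)

lemma UN_dirlim_class:
  assumes x: "x \<in> carrier (B m)"
    and eq: "\<And>k y l. \<lbrakk>y \<in> carrier (B k); m \<le> l; k \<le> l; h m l x = h k l y\<rbrakk> \<Longrightarrow> g k y = G"
  shows "(\<Union>(k, y)\<in>cls m x. g k y) = G"
proof -
  have "(m, x) \<in> cls m x"
    using x by (auto simp: mem_dirlim_class)
  moreover have "g k y = G" if "(k, y) \<in> cls m x" for k y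
    using that x eq by (auto simp: mem_dirlim_class)
  ultimately show ?thesis by fastforce
qed

text \<open>
  Representatives of two classes agree with the given ones at a later stage, so a binary operation
  that commutes with the structure maps is computed there.
\<close>

lemma dirlim_binary_op:
  assumes x: "x \<in> carrier (B m)" and y: "y \<in> carrier (B m)"
    and closed: "\<And>m x y. \<lbrakk>x \<in> carrier (B m); y \<in> carrier (B m)\<rbrakk> \<Longrightarrow> f m x y \<in> carrier (B m)"
    and natural: "\<And>m k x y. \<lbrakk>m \<le> k; x \<in> carrier (B m); y \<in> carrier (B m)\<rbrakk> \<Longrightarrow>
      h m k (f m x y) = f k (h m k x) (h m k y)"
  shows "(\<Union>(k, u)\<in>cls m x. \<Union>(l, v)\<in>cls m y.
    cls (max k l) (f (max k l) (h k (max k l) u) (h l (max k l) v))) = cls m (f m x y)"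
proof (intro UN_dirlim_class x y)
  fix k u i l v j
  assume u: "u \<in> carrier (B k)" "m \<le> i" "k \<le> i" "h m i x = h k i u"
    and v: "v \<in> carrier (B l)" "m \<le> j" "l \<le> j" "h m j y = h l j v"
  define n where "n = max i j"
  have n: "max k l \<le> n" "m \<le> n" "k \<le> n" "l \<le> n"
    using u v by (auto simp: n_def)
  have xn: "h m n x = h k n u"
    by (rule dirlim_rel_mono[OF u(2,3) _ x u(1,4)]) (simp add: n_def)
  have yn: "h m n y = h l n v"
    by (rule dirlim_rel_mono[OF v(2,3) _ y v(1,4)]) (simp add: n_def)
  have "h (max k l) n (f (max k l) (h k (max k l) u) (h l (max k l) v)) = f n (h k n u) (h l n v)"
    using u(1) v(1) n by (simp add: natural map_closed map_comp)
  also have "\<dots> = h m n (f m x y)"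
    using x y n by (simp add: natural xn yn)
  finally show "cls (max k l) (f (max k l) (h k (max k l) u) (h l (max k l) v)) = cls m (f m x y)"
    using x y u(1) v(1) n by (intro dirlim_class_eqI[of _ _ _ _ n]) (simp_all add: closed map_closed)
qed

lemma dirlim_class_add:
  assumes "x \<in> carrier (B m)" "y \<in> carrier (B m)"
  shows "cls m x \<oplus>\<^bsub>dirlim B h\<^esub> cls m y = cls m (x \<oplus>\<^bsub>B m\<^esub> y)"
proof -
  note ring = unital_algebraD(1)[OF stage]
  show ?thesis
    using dirlim_binary_op[OF assms, of "\<lambda>m. (\<oplus>\<^bsub>B m\<^esub>)"]
    by (simp add: dirlim_def ring.ring_simprules(1)[OF ring] alg_homD(2)[OF map_hom])
qed

lemma dirlim_class_mult:
  assumes "x \<in> carrier (B m)" "y \<in> carrier (B m)"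
  shows "cls m x \<otimes>\<^bsub>dirlim B h\<^esub> cls m y = cls m (x \<otimes>\<^bsub>B m\<^esub> y)"
proof -
  note ring = unital_algebraD(1)[OF stage]
  show ?thesis
    using dirlim_binary_op[OF assms, of "\<lambda>m. (\<otimes>\<^bsub>B m\<^esub>)"]
    by (simp add: dirlim_def ring.ring_simprules(5)[OF ring] alg_homD(3)[OF map_hom])
qed

lemma dirlim_class_smult:
  assumes x: "x \<in> carrier (B m)"
  shows "c \<odot>\<^bsub>dirlim B h\<^esub> cls m x = cls m (c \<odot>\<^bsub>B m\<^esub> x)"
proof -
  have "cls k (c \<odot>\<^bsub>B k\<^esub> y) = cls m (c \<odot>\<^bsub>B m\<^esub> x)"
    if "y \<in> carrier (B k)" "m \<le> l" "k \<le> l" "h m l x = h k l y" for k y l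
    using that(1-3) that(4)[symmetric] x
    by (intro dirlim_class_eqI[of _ _ _ _ l]) (simp_all add: unital_algebra_smult(1)[OF stage] alg_homD(4)[OF map_hom])
  then have "(\<Union>(k, y)\<in>cls m x. cls k (c \<odot>\<^bsub>B k\<^esub> y)) = cls m (c \<odot>\<^bsub>B m\<^esub> x)"
    by (intro UN_dirlim_class x)
  then show ?thesis
    by (simp add: dirlim_def)
qed

lemma dirlim_class_hom: "cls m \<in> alg_hom (B m) (dirlim B h)"
proof (rule alg_homI)
  have "cls m (h 0 m \<one>\<^bsub>B 0\<^esub>) = cls 0 \<one>\<^bsub>B 0\<^esub>"
    using ring.ring_simprules(6)[OF unital_algebraD(1)[OF stage]] by (intro dirlim_class_push) auto
  then show "cls m \<one>\<^bsub>B m\<^esub> = \<one>\<^bsub>dirlim B h\<^esub>"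
    by (simp add: dirlim_def alg_homD(5)[OF map_hom])
qed (auto simp: carrier_dirlim dirlim_class_add dirlim_class_mult dirlim_class_smult)

lemma dirlim_class_zero: "cls m \<zero>\<^bsub>B m\<^esub> = \<zero>\<^bsub>dirlim B h\<^esub>"
proof -
  have zero: "\<zero>\<^bsub>B k\<^esub> \<in> carrier (B k)" for k
    using ring.ring_simprules(2)[OF unital_algebraD(1)[OF stage]] .
  have "h 0 m \<zero>\<^bsub>B 0\<^esub> = 0 \<odot>\<^bsub>B m\<^esub> h 0 m \<zero>\<^bsub>B 0\<^esub>"
    using alg_homD(4)[OF map_hom[of 0 m] zero, of 0] unital_algebra_smult(7)[OF stage] by simp
  also have "\<dots> = \<zero>\<^bsub>B m\<^esub>"
    by (intro unital_algebra_smult(6)[OF stage] map_closed zero) simp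
  finally show ?thesis
    using dirlim_class_push[of 0 m, OF _ zero] by (simp add: dirlim_def)
qed

lemma dirlim_stage_mono: "m \<le> k \<Longrightarrow> cls m ` carrier (B m) \<subseteq> cls k ` carrier (B k)"
  using dirlim_class_push map_closed by (metis image_eqI image_subsetI)

lemma unital_algebra_dirlim: "unital_algebra (dirlim B h)"
  by (rule unital_algebra_directed_image[of B "dirlim_class B h"])
    (simp_all add: stage dirlim_class_hom dirlim_class_zero dirlim_stage_mono carrier_dirlim)

end


section \<open>The infinite tensor product\<close>

locale tensor_sequence =
  fixes A :: "nat \<Rightarrow> ('f::field, 'a) module"
  assumes unital_factor: "1 \<le> i \<Longrightarrow> unital_algebra (A i)"
begin

lemma initial_family: "algebra_family {1..m} A"
  by (rule algebra_family.intro) (simp add: unital_factor)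

sublocale directed_system "fin_tensor A" "fin_tensor_map A"
proof
  show "unital_algebra (fin_tensor A m)" for m
    unfolding fin_tensor_def by (rule algebra_family.unital_algebra_tensor_product[OF initial_family])
  show "fin_tensor_map A m k \<in> alg_hom (fin_tensor A m) (fin_tensor A k)" if "m \<le> k" for m k
    unfolding fin_tensor_def fin_tensor_map_def
    using that by (intro algebra_family.fill_units_hom[OF initial_family]) auto
  fix x m assume x: "x \<in> carrier (fin_tensor A m)"
  then obtain p where p: "x = tensor_class {1..m} A p" "Poly_Mapping.keys p \<subseteq> (\<Pi>\<^sub>E i\<in>{1..m}. carrier (A i))"
    unfolding fin_tensor_def algebra_family.carrier_tensor_product[OF initial_family] by blast
  have map: "fin_tensor_map A m k (tensor_class {1..m} A q)
      = tensor_class {1..k} A (lin_ext (fill_tuple A {1..m} {1..k}) q)" if "m \<le> k" for m k q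
    unfolding fin_tensor_map_def
    using that by (intro algebra_family.fill_units_tensor_class[OF initial_family]) auto
  have "lin_ext (fill_tuple A {1..m} {1..m}) p = lin_ext (\<lambda>x. x) p"
    using p(2) by (intro lin_ext_cong fill_tuple_id) (auto simp: PiE_def)
  then show "fin_tensor_map A m m x = x"
    using p(1) by (simp add: map lin_ext_id del: One_nat_def)
  show "fin_tensor_map A k l (fin_tensor_map A m k x) = fin_tensor_map A m l x"
    if "m \<le> k" "k \<le> l" for k l
  proof -
    have "fill_tuple A {1..k} {1..l} \<circ> fill_tuple A {1..m} {1..k} = fill_tuple A {1..m} {1..l}"
      using that by (auto simp: fun_eq_iff fill_tuple_fill_tuple)
    then show ?thesis
      using p(1) that by (simp add: map lin_ext_comp del: One_nat_def)
  qed
qed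

definition head_tensor :: "nat \<Rightarrow> ('f, 'a) inf_tensor_elem set" where
  "head_tensor m = dirlim_class (fin_tensor A) (fin_tensor_map A) m ` carrier (fin_tensor A m)"

lemma unital_algebra_inf_tensor: "unital_algebra (inf_tensor A)"
  unfolding inf_tensor_def by (rule unital_algebra_dirlim)

lemma carrier_inf_tensor: "carrier (inf_tensor A) = (\<Union>m. head_tensor m)"
  unfolding inf_tensor_def head_tensor_def by (rule carrier_dirlim)

lemma head_tensor_mono: "m \<le> k \<Longrightarrow> head_tensor m \<subseteq> head_tensor k"
  unfolding head_tensor_def by (rule dirlim_stage_mono)

lemma head_tensor_closed:
  "\<lbrakk>x \<in> head_tensor m; y \<in> head_tensor m\<rbrakk> \<Longrightarrow> x \<oplus>\<^bsub>inf_tensor A\<^esub> y \<in> head_tensor m"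
  "x \<in> head_tensor m \<Longrightarrow> c \<odot>\<^bsub>inf_tensor A\<^esub> x \<in> head_tensor m"
  "\<zero>\<^bsub>inf_tensor A\<^esub> \<in> head_tensor m"
  unfolding inf_tensor_def head_tensor_def
  using dirlim_class_add[of _ m] dirlim_class_smult[of _ m c] dirlim_class_zero[of m]
    ring.ring_simprules(1,2)[OF unital_algebraD(1)[OF stage]] unital_algebra_smult(1)[OF stage]
  by auto

lemma head_tensor_submodule:
  "LinearCombinations.submodule class_ring (head_tensor m) (inf_tensor A)"
  using head_tensor_closed(1,2)[of _ m] head_tensor_closed(3)[of m] carrier_inf_tensor unital_algebraD(2)[OF unital_algebra_inf_tensor]
  by (intro LinearCombinations.submodule.intro) auto

text \<open>
  Filling in units at the stage \<open>m\<close> and then passing to a later stage \<open>l\<close> is filling in units at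
  \<open>l\<close>, so classes given at different stages can be compared at a common one.
\<close>

lemma dirlim_class_fill:
  assumes J: "J \<subseteq> {1..m}" and l: "m \<le> l" and p: "Poly_Mapping.keys p \<subseteq> (\<Pi>\<^sub>E i\<in>J. carrier (A i))"
  shows "cls m (fill_units A J {1..m} (tensor_class J A p))
    = cls l (tensor_class {1..l} A (lin_ext (fill_tuple A J {1..l}) p))"
proof -
  have ml: "{1..m} \<subseteq> {1..l}"
    using l by auto
  have "fill_units A J {1..m} (tensor_class J A p)
      = tensor_class {1..m} A (lin_ext (fill_tuple A J {1..m}) p)" (is "?X = _")
    by (rule algebra_family.fill_units_tensor_class[OF initial_family J])
  moreover have "Poly_Mapping.keys (lin_ext (fill_tuple A J {1..m}) p) \<subseteq> (\<Pi>\<^sub>E i\<in>{1..m}. carrier (A i))"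
    by (rule algebra_family.keys_fill[OF initial_family J p])
  ultimately have "?X \<in> carrier (fin_tensor A m)"
    unfolding fin_tensor_def algebra_family.carrier_tensor_product[OF initial_family] by blast
  then have "cls m ?X = cls l (fin_tensor_map A m l ?X)"
    by (rule dirlim_class_push[OF l, symmetric])
  also have "fill_tuple A {1..m} {1..l} \<circ> fill_tuple A J {1..m} = fill_tuple A J {1..l}"
    by (simp add: fun_eq_iff fill_tuple_fill_tuple[OF J ml] del: One_nat_def)
  then have "fin_tensor_map A m l ?X = tensor_class {1..l} A (lin_ext (fill_tuple A J {1..l}) p)"
    by (simp only: \<open>?X = _\<close> fin_tensor_map_def algebra_family.fill_units_tensor_class[OF initial_family ml] lin_ext_comp)
  finally show ?thesis .
qed

text \<open>
  Both classes have representatives at one stage that are combinations of tuples with units outside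
  the disjoint index sets \<open>{1..n}\<close> and \<open>{Suc n..m}\<close>.
\<close>

lemma tail_commutes_with_head:
  assumes x: "x \<in> head_tensor n" and y: "y \<in> tail_tensor A (Suc n)"
  shows "x \<otimes>\<^bsub>inf_tensor A\<^esub> y = y \<otimes>\<^bsub>inf_tensor A\<^esub> x"
proof -
  obtain m Y where Y: "y = cls m (fill_units A {Suc n..m} {1..m} Y)" "Y \<in> carrier (tensor_product {Suc n..m} A)"
    using y unfolding tail_tensor_def by blast
  define l where "l = max m n"
  interpret family: algebra_family "{1..l}" A
    by (rule initial_family)
  have tail_family: "algebra_family {Suc n..m} A"
    by (rule algebra_family.subfamily[OF initial_family[of m]]) auto
  obtain q where q: "Y = tensor_class {Suc n..m} A q" "Poly_Mapping.keys q \<subseteq> (\<Pi>\<^sub>E i\<in>{Suc n..m}. carrier (A i))"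
    using Y(2) unfolding algebra_family.carrier_tensor_product[OF tail_family] by blast
  obtain p where p: "x = cls n (tensor_class {1..n} A p)" "Poly_Mapping.keys p \<subseteq> (\<Pi>\<^sub>E i\<in>{1..n}. carrier (A i))"
    using x unfolding head_tensor_def fin_tensor_def algebra_family.carrier_tensor_product[OF initial_family] by blast
  have J: "{Suc n..m} \<subseteq> {1..l}" and K: "{1..n} \<subseteq> {1..l}"
    by (auto simp: l_def)
  have yl: "y = cls l (tensor_class {1..l} A (lin_ext (fill_tuple A {Suc n..m} {1..l}) q))"
    unfolding Y(1) q(1) using q(2) by (intro dirlim_class_fill) (auto simp: l_def)
  have "tensor_class {1..n} A p \<in> carrier (fin_tensor A n)"
    unfolding fin_tensor_def algebra_family.carrier_tensor_product[OF initial_family] using p(2) by blast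
  then have "x = cls n (fill_units A {1..n} {1..n} (tensor_class {1..n} A p))"
    using map_id[of _ n] p(1) by (simp add: fin_tensor_map_def del: One_nat_def)
  also have "\<dots> = cls l (tensor_class {1..l} A (lin_ext (fill_tuple A {1..n} {1..l}) p))"
    using p(2) by (intro dirlim_class_fill) (auto simp: l_def)
  finally have xl: "x = \<dots>" .
  have keys: "Poly_Mapping.keys (lin_ext (fill_tuple A {Suc n..m} {1..l}) q) \<subseteq> family.tuples"
    "Poly_Mapping.keys (lin_ext (fill_tuple A {1..n} {1..l}) p) \<subseteq> family.tuples"
    by (rule family.keys_fill[OF J q(2)], rule family.keys_fill[OF K p(2)])
  have carrier: "tensor_class {1..l} A r \<in> carrier (fin_tensor A l)" if "Poly_Mapping.keys r \<subseteq> family.tuples" for r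
    unfolding fin_tensor_def family.carrier_tensor_product using that by blast
  have "lin_ext (fill_tuple A {1..n} {1..l}) p \<otimes>\<^bsub>family.F\<^esub> lin_ext (fill_tuple A {Suc n..m} {1..l}) q
      = lin_ext (fill_tuple A {Suc n..m} {1..l}) q \<otimes>\<^bsub>family.F\<^esub> lin_ext (fill_tuple A {1..n} {1..l}) p"
    by (rule family.fill_mult_commute[OF K J _ p(2) q(2)]) auto
  then show ?thesis
    unfolding xl yl inf_tensor_def
    using keys by (simp add: dirlim_class_mult carrier fin_tensor_def[symmetric] family.tensor_class_mult[folded fin_tensor_def] del: One_nat_def)
qed

end

section \<open>Inner automorphisms\<close>

lemma alg_auto_id: "(\<lambda>x\<in>carrier R. x) \<in> alg_auto R" if "unital_algebra R"
proof -
  interpret ring R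
    using that by (rule unital_algebraD(1))
  show ?thesis
    unfolding alg_auto_def
    by (auto intro!: alg_homI id_Bij simp: unital_algebra_smult(1)[OF that])
qed

lemma alg_auto_compose:
  assumes "unital_algebra R" "f \<in> alg_auto R" "g \<in> alg_auto R"
  shows "compose (carrier R) f g \<in> alg_auto R"
proof -
  interpret ring R
    using assms(1) by (rule unital_algebraD(1))
  have f: "f \<in> alg_hom R R" "f \<in> Bij (carrier R)" and g: "g \<in> alg_hom R R" "g \<in> Bij (carrier R)"
    using assms by (auto simp: alg_auto_def)
  have "compose (carrier R) f g \<in> alg_hom R R"
    by (rule alg_homI)
      (simp_all add: compose_eq alg_homD[OF f(1)] alg_homD[OF g(1)] unital_algebra_smult(1)[OF assms(1)])
  then show ?thesis
    using compose_Bij[OF f(2) g(2)] by (simp add: alg_auto_def)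
qed

lemma conjugation_compose:
  assumes "ring R" "a \<in> Units R" "b \<in> Units R"
  shows "compose (carrier R) (conjugation R a) (conjugation R b) = conjugation R (b \<otimes>\<^bsub>R\<^esub> a)"
proof -
  interpret ring R by fact
  have ab: "a \<in> carrier R" "b \<in> carrier R" "inv\<^bsub>R\<^esub> a \<in> carrier R" "inv\<^bsub>R\<^esub> b \<in> carrier R"
    using assms by auto
  have "inv\<^bsub>R\<^esub> (b \<otimes>\<^bsub>R\<^esub> a) = inv\<^bsub>R\<^esub> a \<otimes>\<^bsub>R\<^esub> inv\<^bsub>R\<^esub> b"
  proof (rule inv_unique'[symmetric])
    have "b \<otimes>\<^bsub>R\<^esub> a \<otimes>\<^bsub>R\<^esub> (inv\<^bsub>R\<^esub> a \<otimes>\<^bsub>R\<^esub> inv\<^bsub>R\<^esub> b) = b \<otimes>\<^bsub>R\<^esub> (a \<otimes>\<^bsub>R\<^esub> inv\<^bsub>R\<^esub> a) \<otimes>\<^bsub>R\<^esub> inv\<^bsub>R\<^esub> b"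
      using ab by (simp add: m_assoc)
    then show "b \<otimes>\<^bsub>R\<^esub> a \<otimes>\<^bsub>R\<^esub> (inv\<^bsub>R\<^esub> a \<otimes>\<^bsub>R\<^esub> inv\<^bsub>R\<^esub> b) = \<one>\<^bsub>R\<^esub>"
      using ab assms by simp
    have "inv\<^bsub>R\<^esub> a \<otimes>\<^bsub>R\<^esub> inv\<^bsub>R\<^esub> b \<otimes>\<^bsub>R\<^esub> (b \<otimes>\<^bsub>R\<^esub> a) = inv\<^bsub>R\<^esub> a \<otimes>\<^bsub>R\<^esub> (inv\<^bsub>R\<^esub> b \<otimes>\<^bsub>R\<^esub> b) \<otimes>\<^bsub>R\<^esub> a"
      using ab by (simp add: m_assoc)
    then show "inv\<^bsub>R\<^esub> a \<otimes>\<^bsub>R\<^esub> inv\<^bsub>R\<^esub> b \<otimes>\<^bsub>R\<^esub> (b \<otimes>\<^bsub>R\<^esub> a) = \<one>\<^bsub>R\<^esub>"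
      using ab assms by simp
  qed (use ab in simp_all)
  then show ?thesis
    using ab by (auto simp: compose_def conjugation_def fun_eq_iff m_assoc)
qed

lemma conjugation_one:
  assumes "ring R" shows "conjugation R \<one>\<^bsub>R\<^esub> = (\<lambda>x\<in>carrier R. x)"
proof -
  interpret ring R by fact
  show ?thesis by (auto simp: conjugation_def fun_eq_iff)
qed

lemma conjugation_auto:
  assumes "unital_algebra R" "a \<in> Units R"
  shows "conjugation R a \<in> alg_auto R"
proof -
  interpret ring R
    using assms(1) by (rule unital_algebraD(1))
  have a: "a \<in> carrier R" "inv\<^bsub>R\<^esub> a \<in> carrier R" "inv\<^bsub>R\<^esub> a \<in> Units R"
    using assms by auto
  have mult: "inv\<^bsub>R\<^esub> a \<otimes>\<^bsub>R\<^esub> (x \<otimes>\<^bsub>R\<^esub> y) \<otimes>\<^bsub>R\<^esub> a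
      = (inv\<^bsub>R\<^esub> a \<otimes>\<^bsub>R\<^esub> x \<otimes>\<^bsub>R\<^esub> a) \<otimes>\<^bsub>R\<^esub> (inv\<^bsub>R\<^esub> a \<otimes>\<^bsub>R\<^esub> y \<otimes>\<^bsub>R\<^esub> a)"
    if "x \<in> carrier R" "y \<in> carrier R" for x y
  proof -
    have "a \<otimes>\<^bsub>R\<^esub> (inv\<^bsub>R\<^esub> a \<otimes>\<^bsub>R\<^esub> (y \<otimes>\<^bsub>R\<^esub> a)) = y \<otimes>\<^bsub>R\<^esub> a"
      using that a assms by (simp add: m_assoc[symmetric])
    then show ?thesis
      using that a by (simp add: m_assoc)
  qed
  have hom: "conjugation R a \<in> alg_hom R R"
    by (rule alg_homI)
      (use a assms in \<open>simp_all add: conjugation_def l_distr r_distr mult unital_algebraD(3,4)[OF assms(1)]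
        unital_algebra_smult(1)[OF assms(1)]\<close>)
  have "bij_betw (conjugation R a) (carrier R) (carrier R)"
  proof (rule bij_betw_byWitness[where f' = "conjugation R (inv\<^bsub>R\<^esub> a)"])
    have "compose (carrier R) (conjugation R (inv\<^bsub>R\<^esub> a)) (conjugation R a) = (\<lambda>x\<in>carrier R. x)"
      "compose (carrier R) (conjugation R a) (conjugation R (inv\<^bsub>R\<^esub> a)) = (\<lambda>x\<in>carrier R. x)"
      using assms a by (simp_all add: conjugation_compose ring_axioms conjugation_one)
    then show "\<forall>x\<in>carrier R. conjugation R (inv\<^bsub>R\<^esub> a) (conjugation R a x) = x"
      "\<forall>x\<in>carrier R. conjugation R a (conjugation R (inv\<^bsub>R\<^esub> a) x) = x"
      by (metis compose_eq restrict_apply')+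
    show "conjugation R a ` carrier R \<subseteq> carrier R" "conjugation R (inv\<^bsub>R\<^esub> a) ` carrier R \<subseteq> carrier R"
      using a assms by (auto simp: conjugation_def)
  qed
  then show ?thesis
    using hom by (simp add: alg_auto_def Bij_def conjugation_def)
qed

lemma subgroup_Inn:
  assumes "unital_algebra R"
  shows "subgroup (conjugation R ` Units R) (BijGroup (carrier R))"
proof -
  interpret ring R
    using assms by (rule unital_algebraD(1))
  interpret B: group "BijGroup (carrier R)"
    by (rule group_BijGroup)
  have Bij: "conjugation R a \<in> Bij (carrier R)" if "a \<in> Units R" for a
    using conjugation_auto[OF assms that] by (simp add: alg_auto_def)
  have mult: "conjugation R a \<otimes>\<^bsub>BijGroup (carrier R)\<^esub> conjugation R b = conjugation R (b \<otimes>\<^bsub>R\<^esub> a)"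
    if "a \<in> Units R" "b \<in> Units R" for a b
    using that Bij by (simp add: BijGroup_def conjugation_compose ring_axioms)
  show ?thesis
  proof (rule B.subgroupI)
    show "conjugation R ` Units R \<subseteq> carrier (BijGroup (carrier R))"
      using Bij by (auto simp: BijGroup_def)
    show "conjugation R ` Units R \<noteq> {}"
      using Units_one_closed by blast
    fix f assume "f \<in> conjugation R ` Units R"
    then obtain a where a: "a \<in> Units R" "f = conjugation R a" by blast
    then have "conjugation R (inv\<^bsub>R\<^esub> a) \<otimes>\<^bsub>BijGroup (carrier R)\<^esub> f = \<one>\<^bsub>BijGroup (carrier R)\<^esub>"
      by (simp add: mult conjugation_one ring_axioms) (simp add: BijGroup_def)
    then have "inv\<^bsub>BijGroup (carrier R)\<^esub> f = conjugation R (inv\<^bsub>R\<^esub> a)"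
      using a Bij by (intro B.inv_equality) (auto simp: BijGroup_def)
    then show "inv\<^bsub>BijGroup (carrier R)\<^esub> f \<in> conjugation R ` Units R"
      using a by simp
    fix g assume "g \<in> conjugation R ` Units R"
    then obtain b where "b \<in> Units R" "g = conjugation R b" by blast
    with a show "f \<otimes>\<^bsub>BijGroup (carrier R)\<^esub> g \<in> conjugation R ` Units R"
      by (simp add: mult)
  qed
qed

lemma Inn_group: "unital_algebra R \<Longrightarrow> group (Inn R)"
  unfolding Inn_def by (rule subgroup.subgroup_is_group[OF subgroup_Inn group_BijGroup])

lemma Inn_auto: "\<lbrakk>unital_algebra R; f \<in> carrier (Inn R)\<rbrakk> \<Longrightarrow> f \<in> alg_auto R"
  using conjugation_auto by (auto simp: Inn_def)

text \<open>
  The inverse in a subgroup of \<^const>\<open>BijGroup\<close> is the inverse in the whole group, which is the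
  inverse map.
\<close>

lemma Inn_inv:
  assumes "unital_algebra R" "f \<in> carrier (Inn R)"
  shows "inv\<^bsub>Inn R\<^esub> f = restrict (inv_into (carrier R) f) (carrier R)"
proof -
  have "f \<in> conjugation R ` Units R"
    using assms by (simp add: Inn_def)
  then have "inv\<^bsub>Inn R\<^esub> f = inv\<^bsub>BijGroup (carrier R)\<^esub> f"
    unfolding Inn_def by (rule group.m_inv_consistent[OF group_BijGroup subgroup_Inn[OF assms(1)]])
  also have "\<dots> = restrict (inv_into (carrier R) f) (carrier R)"
    using Inn_auto[OF assms] by (intro inv_BijGroup) (simp add: alg_auto_def)
  finally show ?thesis .
qed

text \<open>
  If \<open>u\<close> commutes with \<open>x\<close>, then \<open>u\<inverse> x u = x\<close>; fixing \<open>P\<close> elementwise passes to inverses and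
  compositions. Membership in \<^const>\<open>Inn\<close> is part of the induction because it makes each
  map a bijection, which the steps for inverses and products use.
\<close>

lemma Inn_centralizer:
  assumes R: "unital_algebra R" and P: "P \<subseteq> carrier R"
    and commute: "\<And>x u. \<lbrakk>x \<in> P; u \<in> T\<rbrakk> \<Longrightarrow> x \<otimes>\<^bsub>R\<^esub> u = u \<otimes>\<^bsub>R\<^esub> x"
    and f: "f \<in> generate (Inn R) (conjugation R ` (T \<inter> Units R))"
  shows "f \<in> carrier (Inn R) \<and> (\<forall>x\<in>P. f x = x)"
proof -
  interpret ring R
    using R by (rule unital_algebraD(1))
  interpret Inn: group "Inn R"
    using R by (rule Inn_group)
  have gen: "conjugation R u \<in> carrier (Inn R) \<and> (\<forall>x\<in>P. conjugation R u x = x)"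
    if u: "u \<in> T \<inter> Units R" for u
  proof -
    have "inv\<^bsub>R\<^esub> u \<otimes>\<^bsub>R\<^esub> x \<otimes>\<^bsub>R\<^esub> u = x" if "x \<in> P" for x
    proof -
      have x: "x \<in> carrier R" and u': "u \<in> carrier R" "inv\<^bsub>R\<^esub> u \<in> carrier R"
        using u that P by auto
      then have "inv\<^bsub>R\<^esub> u \<otimes>\<^bsub>R\<^esub> x \<otimes>\<^bsub>R\<^esub> u = inv\<^bsub>R\<^esub> u \<otimes>\<^bsub>R\<^esub> (u \<otimes>\<^bsub>R\<^esub> x)"
        using u that commute[of x u] by (simp add: m_assoc)
      also have "\<dots> = inv\<^bsub>R\<^esub> u \<otimes>\<^bsub>R\<^esub> u \<otimes>\<^bsub>R\<^esub> x"
        using x u' by (simp add: m_assoc)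
      also have "\<dots> = x"
        using x u by simp
      finally show ?thesis .
    qed
    then show ?thesis
      using u P by (auto simp: Inn_def conjugation_def)
  qed
  show ?thesis
    using f
  proof (induction rule: generate.induct)
    case one
    have "\<one>\<^bsub>Inn R\<^esub> = (\<lambda>x\<in>carrier R. x)"
      by (simp add: Inn_def BijGroup_def)
    then show ?case
      using P Inn.one_closed by (simp only:) (simp add: subset_iff)
  next
    case (incl h)
    then show ?case
      using gen by blast
  next
    case (inv h)
    then have h: "h \<in> carrier (Inn R)" "\<forall>x\<in>P. h x = x"
      using gen by blast+
    then have "inj_on h (carrier R)"
      using Inn_auto[OF R] by (auto simp: alg_auto_def Bij_def bij_betw_def)
    then have "(inv\<^bsub>Inn R\<^esub> h) x = x" if "x \<in> P" for x
      using that h P by (auto simp: Inn_inv[OF R h(1)] intro: inv_into_f_eq)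
    then show ?case
      using Inn.inv_closed[OF h(1)] by blast
  next
    case (eng f g)
    then have "f \<in> Bij (carrier R)" "g \<in> Bij (carrier R)"
      using Inn_auto[OF R] by (auto simp: alg_auto_def)
    then have "f \<otimes>\<^bsub>Inn R\<^esub> g = compose (carrier R) f g"
      by (simp add: Inn_def BijGroup_def)
    moreover have "f \<otimes>\<^bsub>Inn R\<^esub> g \<in> carrier (Inn R)"
      using eng by simp
    ultimately show ?case
      using eng P by (auto simp: compose_eq)
  qed
qed


section \<open>Infinite products of automorphisms along a chain of subspaces\<close>

lemma finite_spans_fin_dim:
  assumes R: "unital_algebra (R :: ('f::field, 'a) module)" and E: "finite E" "E \<subseteq> carrier R"
  shows "spans_fin_dim R E"
proof -
  interpret M: Module.module "class_ring :: 'f ring" R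
    using R by (rule unital_algebraD(2))
  have V: "vectorspace class_ring (R\<lparr>carrier := M.span E\<rparr>)"
    using class_field M.submodule_is_module[OF M.span_is_submodule[OF E(2)]]
    by (simp add: vectorspace_def)
  have "LinearCombinations.module.span class_ring (R\<lparr>carrier := M.span E\<rparr>) E = M.span E"
    by (rule M.span_li_not_depend(1)[OF M.in_own_span[OF E(2)] M.span_is_submodule[OF E(2)]])
  then show ?thesis
    using E(1) M.in_own_span[OF E(2)]
    by (auto simp: spans_fin_dim_def vectorspace.fin_dim_def[OF V])
qed

text \<open>
  A finite generating set of the span lies in one member of the chain, and a submodule that contains
  the generators contains the span.
\<close>

lemma spans_fin_dim_in_chain:
  fixes R :: "('f::field, 'a) module" and P :: "nat \<Rightarrow> 'a set"
  assumes R: "unital_algebra R" and E: "E \<subseteq> carrier R" and fin_dim: "spans_fin_dim R E"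
    and P: "\<And>m. LinearCombinations.submodule class_ring (P m) R" "mono P" "carrier R = (\<Union>m. P m)"
  shows "\<exists>m. E \<subseteq> P m"
proof -
  interpret M: Module.module "class_ring :: 'f ring" R
    using R by (rule unital_algebraD(2))
  have V: "vectorspace class_ring (R\<lparr>carrier := M.span E\<rparr>)"
    using class_field M.submodule_is_module[OF M.span_is_submodule[OF E]]
    by (simp add: vectorspace_def)
  obtain G where G: "finite G" "G \<subseteq> M.span E"
      "LinearCombinations.module.span class_ring (R\<lparr>carrier := M.span E\<rparr>) G = M.span E"
    using fin_dim by (auto simp: spans_fin_dim_def vectorspace.fin_dim_def[OF V])
  have span_G: "M.span G = M.span E"
    using M.span_li_not_depend(1)[OF G(2) M.span_is_submodule[OF E]] G(3) by simp
  have "G \<subseteq> (\<Union>m. P m)"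
    using G(2) M.span_is_subset2[OF E] P(3) by blast
  with G(1) have "\<exists>m. G \<subseteq> P m"
  proof (induction G rule: finite_induct)
    case (insert x G)
    then obtain k l where "x \<in> P k" "G \<subseteq> P l"
      by blast
    then show ?case
      using monoD[OF P(2), of k "max k l"] monoD[OF P(2), of l "max k l"]
      by (intro exI[of _ "max k l"]) auto
  qed simp
  then obtain m where "G \<subseteq> P m" by blast
  then have "M.span G \<subseteq> P m"
    by (rule M.span_is_subset[OF _ P(1)])
  then show ?thesis
    using span_G M.in_own_span[OF E] by auto
qed

text \<open>
  The properties of the infinite tensor product that the comparison of surjectivity and
  integrability rests on. The index of \<open>\<phi>\<close> starts at \<open>1\<close>, and \<open>\<phi> (i + 1)\<close> fixes \<open>P i\<close>.
\<close>

locale automorphism_chain =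
  fixes R :: "('f::field, 'a) module" and P :: "nat \<Rightarrow> 'a set" and \<phi> :: "nat \<Rightarrow> 'a \<Rightarrow> 'a"
  assumes algebra: "unital_algebra R"
    and chain_submodule: "LinearCombinations.submodule class_ring (P m) R"
    and chain_mono: "m \<le> k \<Longrightarrow> P m \<subseteq> P k"
    and chain_cover: "carrier R = (\<Union>m. P m)"
    and step_auto: "\<phi> (Suc i) \<in> alg_auto R"
    and fixes_chain: "x \<in> P i \<Longrightarrow> \<phi> (Suc i) x = x"
begin

lemma partial_product_auto: "partial_product R \<phi> m \<in> alg_auto R"
  by (induction m) (simp_all only: partial_product.simps alg_auto_id alg_auto_compose algebra step_auto)

lemma partial_product_hom: "partial_product R \<phi> m \<in> alg_hom R R"
  and partial_product_bij: "bij_betw (partial_product R \<phi> m) (carrier R) (carrier R)"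
  using partial_product_auto by (auto simp: alg_auto_def Bij_def)

lemma partial_product_stable:
  assumes "x \<in> P k" "k \<le> m"
  shows "partial_product R \<phi> m x = partial_product R \<phi> k x"
  using assms(2)
proof (induction m rule: dec_induct)
  case (step m)
  then have "x \<in> P m" "x \<in> carrier R"
    using assms(1) chain_mono chain_cover by blast+
  with step show ?case
    by (simp add: compose_eq fixes_chain)
qed simp

text \<open>
  Convergence in the product of discrete topologies means that the values at each point are
  eventually constant, and the values at \<open>x \<in> P k\<close> are constant from \<open>k\<close> on. The product topology is
  Hausdorff, so this limit is the one selected by \<^const>\<open>infinite_product\<close>.
\<close>

lemma infinite_product_limit:
  "infinite_product R \<phi> \<in> extensional (carrier R) \<and>
   (\<forall>k. \<forall>x\<in>P k. infinite_product R \<phi> x = partial_product R \<phi> k x)"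
proof -
  define lim where "lim = (\<lambda>x\<in>carrier R. partial_product R \<phi> (LEAST k. x \<in> P k) x)"
  let ?T = "product_topology (\<lambda>_. discrete_topology (carrier R)) (carrier R)"
  have lim: "lim x = partial_product R \<phi> k x" if "x \<in> P k" for x k
  proof -
    have least: "x \<in> P (LEAST k. x \<in> P k)" "(LEAST k. x \<in> P k) \<le> k" and x: "x \<in> carrier R"
      using that LeastI[of "\<lambda>k. x \<in> P k"] Least_le[of "\<lambda>k. x \<in> P k"] chain_cover by auto
    then show ?thesis
      using partial_product_stable[OF least] by (simp add: lim_def)
  qed
  have "limitin ?T (partial_product R \<phi>) lim sequentially"
    unfolding limitin_componentwise
  proof (intro conjI ballI)
    show "lim \<in> extensional (carrier R)"
      by (simp add: lim_def)
    have "partial_product R \<phi> m \<in> topspace ?T" for m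
      using partial_product_auto[of m] Bij_imp_funcset[of "partial_product R \<phi> m"]
      by (auto simp: alg_auto_def PiE_def Bij_imp_extensional)
    then show "\<forall>\<^sub>F m in sequentially. partial_product R \<phi> m \<in> topspace ?T"
      by simp
    fix x assume "x \<in> carrier R"
    then obtain k where k: "x \<in> P k"
      using chain_cover by blast
    have "lim x \<in> carrier R"
      using lim[OF k] alg_homD(1)[OF partial_product_hom \<open>x \<in> carrier R\<close>] by simp
    moreover have "\<forall>\<^sub>F m in sequentially. partial_product R \<phi> m x = lim x"
      by (rule eventually_sequentiallyI[of k]) (rule trans[OF partial_product_stable[OF k] lim[OF k, symmetric]])
    ultimately show "limitin (discrete_topology (carrier R)) (\<lambda>m. partial_product R \<phi> m x) (lim x) sequentially"
      by (auto simp: limitin_def elim: eventually_mono)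
  qed
  moreover have "Hausdorff_space ?T"
    by (simp add: Hausdorff_space_product_topology)
  ultimately have "infinite_product R \<phi> = lim"
    unfolding infinite_product_def
    by (intro the_equality) (auto intro: limitin_Hausdorff_unique)
  then show ?thesis
    using lim by (auto simp: lim_def)
qed

lemma infinite_product_eq: "x \<in> P k \<Longrightarrow> infinite_product R \<phi> x = partial_product R \<phi> k x"
  using infinite_product_limit by blast

lemma common_stage:
  assumes "x \<in> carrier R" "y \<in> carrier R"
  obtains k where "x \<in> P k" "y \<in> P k"
proof -
  obtain k l where "x \<in> P k" "y \<in> P l"
    using assms chain_cover by blast
  then show ?thesis
    using that[of "max k l"] chain_mono[of k "max k l"] chain_mono[of l "max k l"] by auto
qed

text \<open>
  Finitely many elements lie in one \<open>P k\<close>, where the infinite product agrees with an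
  automorphism.
\<close>

lemma infinite_product_hom: "infinite_product R \<phi> \<in> alg_hom R R"
proof (rule alg_homI)
  interpret ring R
    using algebra by (rule unital_algebraD(1))
  fix x assume x: "x \<in> carrier R"
  show "infinite_product R \<phi> x \<in> carrier R"
    using common_stage[OF x x] infinite_product_eq alg_homD(1)[OF partial_product_hom x] by metis
  show "infinite_product R \<phi> (c \<odot>\<^bsub>R\<^esub> x) = c \<odot>\<^bsub>R\<^esub> infinite_product R \<phi> x" for c
  proof -
    have cx: "c \<odot>\<^bsub>R\<^esub> x \<in> carrier R"
      using unital_algebra_smult(1)[OF algebra x] .
    obtain k where "x \<in> P k" "c \<odot>\<^bsub>R\<^esub> x \<in> P k"
      using common_stage[OF x cx] .
    then show ?thesis
      by (simp add: infinite_product_eq alg_homD(4)[OF partial_product_hom x])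
  qed
  fix y assume y: "y \<in> carrier R"
  have stage: "\<exists>k. x \<in> P k \<and> y \<in> P k \<and> z \<in> P k" if z: "z \<in> carrier R" for z
  proof -
    obtain k where k: "x \<in> P k" "y \<in> P k"
      using common_stage[OF x y] .
    obtain l where l: "x \<in> P l" "z \<in> P l"
      using common_stage[OF x z] .
    show ?thesis
      using k l chain_mono[of k "max k l"] chain_mono[of l "max k l"] by auto
  qed
  show "infinite_product R \<phi> (x \<oplus>\<^bsub>R\<^esub> y) = infinite_product R \<phi> x \<oplus>\<^bsub>R\<^esub> infinite_product R \<phi> y"
    using stage[of "x \<oplus>\<^bsub>R\<^esub> y"] x y alg_homD(2)[OF partial_product_hom x y]
    by (auto simp: infinite_product_eq)
  show "infinite_product R \<phi> (x \<otimes>\<^bsub>R\<^esub> y) = infinite_product R \<phi> x \<otimes>\<^bsub>R\<^esub> infinite_product R \<phi> y"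
    using stage[of "x \<otimes>\<^bsub>R\<^esub> y"] x y alg_homD(3)[OF partial_product_hom x y]
    by (auto simp: infinite_product_eq)
next
  have "\<one>\<^bsub>R\<^esub> \<in> carrier R"
    using unital_algebraD(1)[OF algebra] by (simp add: ring.ring_simprules(6))
  then show "infinite_product R \<phi> \<one>\<^bsub>R\<^esub> = \<one>\<^bsub>R\<^esub>"
    using common_stage[of "\<one>\<^bsub>R\<^esub>" "\<one>\<^bsub>R\<^esub>"] infinite_product_eq alg_homD(5)[OF partial_product_hom] by metis
qed

lemma infinite_product_inj: "inj_on (infinite_product R \<phi>) (carrier R)"
proof (rule inj_onI)
  fix x y assume xy: "x \<in> carrier R" "y \<in> carrier R" "infinite_product R \<phi> x = infinite_product R \<phi> y"
  obtain k where "x \<in> P k" "y \<in> P k"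
    using common_stage[OF xy(1,2)] .
  then show "x = y"
    using xy bij_betw_imp_inj_on[OF partial_product_bij[of k]] by (simp add: infinite_product_eq inj_on_def)
qed

lemma infinite_product_auto_iff:
  "infinite_product R \<phi> \<in> alg_auto R \<longleftrightarrow> carrier R \<subseteq> infinite_product R \<phi> ` carrier R"
  using infinite_product_hom infinite_product_inj infinite_product_limit alg_homD(1)[OF infinite_product_hom]
  by (auto simp: alg_auto_def Bij_def bij_betw_def)

text \<open>
  The orbit of \<open>a\<close> under right inverses \<open>\<psi> i\<close> of \<open>\<phi> i\<close> consists of the preimages of \<open>a\<close> under the
  partial products. Surjectivity of the limit says that these preimages stabilize, and a
  finite-dimensional span forces the orbit into one \<open>P m\<close>, where the limit can be evaluated.
\<close>

theorem infinite_product_auto_iff_orbits: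
  assumes \<psi>: "\<And>i x. x \<in> carrier R \<Longrightarrow> \<psi> (Suc i) x \<in> carrier R \<and> \<phi> (Suc i) (\<psi> (Suc i) x) = x"
  shows "infinite_product R \<phi> \<in> alg_auto R \<longleftrightarrow>
    (\<forall>a\<in>carrier R. spans_fin_dim R {iterated_image \<psi> n a | n. n \<ge> 1})"
proof -
  have orbit: "iterated_image \<psi> n a \<in> carrier R \<and> partial_product R \<phi> n (iterated_image \<psi> n a) = a"
    if "a \<in> carrier R" for a n
    by (induction n) (simp_all add: that \<psi> compose_eq)
  show ?thesis
    unfolding infinite_product_auto_iff
  proof (intro iffI ballI subsetI)
    fix a assume "carrier R \<subseteq> infinite_product R \<phi> ` carrier R" and a: "a \<in> carrier R"
    then obtain b where b: "b \<in> carrier R" "a = infinite_product R \<phi> b"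
      by blast
    obtain k where k: "b \<in> P k"
      using b(1) chain_cover by blast
    have tail: "iterated_image \<psi> n a = b" if "k \<le> n" for n
    proof (rule inj_onD[OF bij_betw_imp_inj_on[OF partial_product_bij[of n]]])
      show "partial_product R \<phi> n (iterated_image \<psi> n a) = partial_product R \<phi> n b"
        using orbit[OF a, of n] b(2) infinite_product_eq[of b n] k chain_mono[OF that] by auto
    qed (use orbit[OF a] b in auto)
    have "iterated_image \<psi> n a \<in> insert b ((\<lambda>n. iterated_image \<psi> n a) ` {..k})" for n
      using tail[of n] by (cases "k \<le> n") auto
    then have "{iterated_image \<psi> n a | n. n \<ge> 1} \<subseteq> insert b ((\<lambda>n. iterated_image \<psi> n a) ` {..k})"
      by blast
    then have "finite {iterated_image \<psi> n a | n. n \<ge> 1}"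
      by (rule finite_subset) simp
    then show "spans_fin_dim R {iterated_image \<psi> n a | n. n \<ge> 1}"
      using orbit[OF a] by (intro finite_spans_fin_dim algebra) auto
  next
    fix a assume fin_dim: "\<forall>a\<in>carrier R. spans_fin_dim R {iterated_image \<psi> n a | n. n \<ge> 1}"
      and a: "a \<in> carrier R"
    have "\<exists>m. {iterated_image \<psi> n a | n. n \<ge> 1} \<subseteq> P m"
      using fin_dim a orbit[OF a] chain_cover chain_mono
      by (intro spans_fin_dim_in_chain[OF algebra]) (auto simp: mono_def chain_submodule)
    then obtain m where m: "{iterated_image \<psi> n a | n. n \<ge> 1} \<subseteq> P m" by blast
    \<comment> \<open>The orbit is indexed from \<open>1\<close>, so the stage \<open>m\<close>, which may be \<open>0\<close>, is replaced by its successor.\<close>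
    define k where "k = Suc m"
    have "1 \<le> k"
      by (simp add: k_def)
    then have "iterated_image \<psi> k a \<in> P m"
      using m by blast
    then have "iterated_image \<psi> k a \<in> P k"
      using chain_mono[of m k] by (auto simp: k_def)
    then have "infinite_product R \<phi> (iterated_image \<psi> k a) = a"
      using orbit[OF a] by (simp add: infinite_product_eq)
    then show "a \<in> infinite_product R \<phi> ` carrier R"
      using orbit[OF a, of k] by (metis image_eqI)
  qed
qed

end


section \<open>Automorphisms and integrability\<close>

theorem theorem5:
  fixes A :: "nat \<Rightarrow> ('f::field, 'a) module"
    and n :: "nat \<Rightarrow> nat"
    and \<phi> :: "nat \<Rightarrow> ('f, 'a) inf_tensor_elem \<Rightarrow> ('f, 'a) inf_tensor_elem"
  assumes "\<And>i. 1 \<le> i \<Longrightarrow> unital_algebra (A i)"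
    and "\<And>i. 1 \<le> i \<Longrightarrow> 0 < n i \<and> alg_isomorphic (A i) (matrix_algebra (n i))"
    and "locally_matrix_algebra (inf_tensor A)"
    and "countable_dimensional (inf_tensor A)"
    and "\<And>i. 1 \<le> i \<Longrightarrow> \<phi> i \<in> tail_inner A i"
  shows "infinite_product (inf_tensor A) \<phi> \<in> alg_auto (inf_tensor A) \<longleftrightarrow>
    integrable_seq A (\<lambda>i. inv\<^bsub>Inn (inf_tensor A)\<^esub> (\<phi> i))"
proof -
  interpret tensor_sequence A
    by (rule tensor_sequence.intro) (rule assms(1))
  let ?R = "inf_tensor A"
  have head_carrier: "head_tensor i \<subseteq> carrier ?R" for i
    using carrier_inf_tensor by blast
  have \<phi>: "\<phi> (Suc i) \<in> carrier (Inn ?R) \<and> (\<forall>x\<in>head_tensor i. \<phi> (Suc i) x = x)" for i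
  proof (rule Inn_centralizer[OF unital_algebra_inf_tensor head_carrier tail_commutes_with_head])
    show "\<phi> (Suc i) \<in> generate (Inn ?R) (conjugation ?R ` (tail_tensor A (Suc i) \<inter> Units ?R))"
      using assms(5)[of "Suc i"] by (simp add: tail_inner_def)
  qed
  interpret automorphism_chain ?R head_tensor \<phi>
  proof (rule automorphism_chain.intro)
    show "\<phi> (Suc i) \<in> alg_auto ?R" for i
      using \<phi> Inn_auto[OF unital_algebra_inf_tensor] by blast
    show "\<phi> (Suc i) x = x" if "x \<in> head_tensor i" for i x
      using \<phi> that by blast
  qed (fact unital_algebra_inf_tensor head_tensor_submodule head_tensor_mono carrier_inf_tensor)+
  have inverse: "(inv\<^bsub>Inn ?R\<^esub> (\<phi> (Suc i))) x \<in> carrier ?R \<and> \<phi> (Suc i) ((inv\<^bsub>Inn ?R\<^esub> (\<phi> (Suc i))) x) = x"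
    if "x \<in> carrier ?R" for i x
  proof -
    have "bij_betw (\<phi> (Suc i)) (carrier ?R) (carrier ?R)"
      using step_auto[of i] by (simp add: alg_auto_def Bij_def)
    then show ?thesis
      using that \<phi>[of i]
      by (simp add: Inn_inv[OF unital_algebra_inf_tensor] bij_betw_def inv_into_into f_inv_into_f)
  qed
  have "inv\<^bsub>Inn ?R\<^esub> (\<phi> i) \<in> tail_inner A i" if "1 \<le> i" for i
    using assms(5)[OF that] unfolding tail_inner_def
    by (intro group.generate_m_inv_closed[OF Inn_group[OF unital_algebra_inf_tensor]]) (auto simp: Inn_def)
  then show ?thesis
    using infinite_product_auto_iff_orbits[OF inverse] by (simp add: integrable_seq_def)
qed

end
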